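(* Let $d\ge1$, $a>0$, and $\bar D=\mathbb{R}^+\times\mathbb{R}^{d-1}$. The dynamical cost $\underline C$ (see context) is weakly lower semicontinuous in $H^1$, coercive, and induces the static cost $c$ (see context) in the sense that for all $x,y\in\bar D$ $$c(x,y)=\min\left\{\int_0^1\underline L(\omega_t,\dot\omega_t)\,\mathrm{d}t:\ \omega\in H^1(0,1;\bar D)\text{ and }\omega_0=x,\ \omega_1=y\right\}.$$ The minimum is always attained for a unique geodesic $(\gamma^{xy}_t)_{t\in[0,1]}\in H^1(0,1;\bar D)$. Moreover: - For $a\le1$, geodesics are the standard Euclidean interpolants $\gamma^{xy}_t=(1-t)x+ty$. - For $a>1$, let $\alpha\in(0,\pi/2)$ be defined by $\sin^2\alpha=\frac1a$. If $y\notin\mathfrak C(x)$, the geodesic is a concatenation of at most three straight segments $x\to z_{\rm in}\to z_{\rm out}\to y$ with $z_{\rm in},z_{\rm out}\in\partial D$, where the segments $[x,z_{\rm in}]$ and $[z_{\rm out},y]$ make an angle $\alpha$ with the normal direction to $\partial D$ and $[z_{\rm in},z_{\rm out}]$ is contained in the boundary $\partial D$; that is, with $e=\frac{y'-x'}{|y'-x'|}$, $z_{\rm in}=(0,\,x'+x_1\tan\alpha\, e)$ and $z_{\rm out}=(0,\,y'-y_1\tan\alpha\, e)$ (so that $z_{\rm in}=x$ if $x_1=0$ and $z_{\rm out}=y$ if $y_1=0$). If $y\in\mathfrak C(x)$, the geodesic is again the Euclidean interpolant $\gamma^{xy}_t=(1-t)x+ty$.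
   Context: Points of $\bar D=\mathbb{R}^+\times\mathbb{R}^{d-1}$ ($\mathbb{R}^+=[0,\infty)$, $\mathbb{R}^0=\{0\}$) are written $x=(x_1,x')$; $D=\{x_1>0\}$ and $\partial D=\{x_1=0\}$. Set $A=a-1$. Lagrangian: if $a\le1$, $\underline L(x,q)=\frac12|q|^2$ for all $x\in\bar D$ and $q\in\mathbb{R}^d$. If $a>1$, $\underline L(x,q)=\frac12|q|^2$ for $x\in D$, $q\in\mathbb{R}^d$, and $\underline L(x,q)=\frac1{2a}|q|^2$ for $x\in\partial D$ and $q$ tangent to $\partial D$ (i.e. $q_1=0$). Only tangent $q$ are considered at boundary points when $a>1$; this suffices because for $\omega\in H^1(0,1;\bar D)$ the velocity $\dot\omega_t$ is tangent to $\partial D$ for a.e. $t$ with $\omega_t\in\partial D$. Dynamical cost: for $\omega\in C([0,1];\bar D)$, $\underline C(\omega)=\int_0^1\underline L(\omega_t,\dot\omega_t)\,\mathrm{d}t$ if $\omega\in H^1$, and $\underline C(\omega)=+\infty$ otherwise. Coercive means that there is a constant $\kappa>0$ with $\underline C(\omega)\ge\kappa\int_0^1|\dot\omega_t|^2\mathrm{d}t$ for all $\omega\in H^1(0,1;\bar D)$. Static cost: if $a\le1$, $c(x,y)=\frac12|x-y|^2$. If $a>1$, $c(x,y)=\frac12|x-y|^2$ if $(x,y)\in\mathfrak C$ and $c(x,y)=\frac1{2a}\left(\sqrt A\,|x_1+y_1|+|y'-x'|\right)^2$ otherwise, where $$\mathfrak C=\left\{(x,y)\in\bar D^2:\ |y'-x'|\le\frac1{\sqrt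 A}\left[|x_1+y_1|+2\sqrt a\sqrt{x_1y_1}\right]\right\},\qquad \mathfrak C(x)=\{y\in\bar D:\ (x,y)\in\mathfrak C\}.$$ A geodesic from $x$ to $y$ means a minimizer of $\int_0^1\underline L(\omega_t,\dot\omega_t)\,\mathrm{d}t$ among all curves $\omega\in H^1(0,1;\bar D)$ with $\omega_0=x$ and $\omega_1=y$.
   Formalization: Uniqueness fails if a>1, x_1,y_1>0 and |y'-x'| equals the bound defining 𝔠, so it is not claimed there; instead, the Euclidean interpolant and a three-segment curve are both geodesics, and every geodesic is of one of these two kinds. *)

theory Defs
  imports "HOL-Analysis.Analysis"
begin

section \<open>Half-space\<close>

text \<open>
  The ambient space is \<open>real ^ 'n\<close> with \<open>d = CARD('n) \<ge> 1\<close>.  An arbitrary but fixed index \<open>k\<close>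
  plays the role of the first coordinate: \<open>x $ k\<close> is \<open>x\<^sub>1\<close>.  The component \<open>x'\<close> is represented by
  the boundary point \<open>(0, x')\<close>, so that \<open>\<bar>y' - x'\<bar>\<close> is \<open>norm (tang k y - tang k x)\<close>.
  For \<open>CARD('n) = 1\<close> this vector is always \<open>0\<close>.
\<close>

definition halfspace :: "'n::finite \<Rightarrow> (real ^ 'n) set" where
  "halfspace k = {x. 0 \<le> x $ k}"

definition bdry :: "'n::finite \<Rightarrow> (real ^ 'n) set" where
  "bdry k = {x. x $ k = 0}"

definition tang :: "'n::finite \<Rightarrow> real ^ 'n \<Rightarrow> real ^ 'n" where
  "tang k x = (\<chi> i. if i = k then 0 else x $ i)"

definition angle :: "'a::real_inner \<Rightarrow> 'a \<Rightarrow> real" where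
  "angle u v = arccos ((u \<bullet> v) / (norm u * norm v))"


section \<open>The Sobolev space of curves\<close>

text \<open>
  A curve on \<open>[0,1]\<close> is a function on all reals of which only the values on \<open>{0..1}\<close> matter.
  Elements of \<open>H\<^sup>1(0,1)\<close> are identified with their continuous representatives, i.e. with the
  primitives of square integrable functions.  The derivative \<open>velocity w\<close> is determined almost
  everywhere on \<open>{0..1}\<close>; all integrals below are insensitive to the choice.
\<close>

definition has_velocity :: "(real \<Rightarrow> real ^ 'n::finite) \<Rightarrow> (real \<Rightarrow> real ^ 'n) \<Rightarrow> bool" where
  "has_velocity w v \<longleftrightarrow>
     set_borel_measurable lborel {0..1} v \<and>
     set_integrable lborel {0..1} (\<lambda>t. (norm (v t))\<^sup>2) \<and>
     (\<forall>t\<in>{0..1}. w t = w 0 + (LINT s:{0..t}|lborel. v s))"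

definition H1 :: "(real \<Rightarrow> real ^ 'n::finite) set" where
  "H1 = {w. \<exists>v. has_velocity w v}"

definition velocity :: "(real \<Rightarrow> real ^ 'n::finite) \<Rightarrow> real \<Rightarrow> real ^ 'n" where
  "velocity w = (SOME v. has_velocity w v)"

definition H1_halfspace :: "'n::finite \<Rightarrow> (real \<Rightarrow> real ^ 'n) set" where
  "H1_halfspace k = {w \<in> H1. \<forall>t\<in>{0..1}. w t \<in> halfspace k}"

definition energy :: "(real \<Rightarrow> real ^ 'n::finite) \<Rightarrow> real" where
  "energy w = (LINT t:{0..1}|lborel. (norm (velocity w t))\<^sup>2)"

definition H1_norm :: "(real \<Rightarrow> real ^ 'n::finite) \<Rightarrow> real" where
  "H1_norm w = sqrt ((LINT t:{0..1}|lborel. (norm (w t))\<^sup>2) + energy w)"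

definition H1_dual :: "((real \<Rightarrow> real ^ 'n::finite) \<Rightarrow> real) set" where
  "H1_dual = {l.
     (\<forall>u\<in>H1. \<forall>w\<in>H1. l (\<lambda>t. u t + w t) = l u + l w) \<and>
     (\<forall>c. \<forall>w\<in>H1. l (\<lambda>t. c *\<^sub>R w t) = c * l w) \<and>
     (\<exists>K. \<forall>w\<in>H1. \<bar>l w\<bar> \<le> K * H1_norm w)}"

text \<open>
  The weak topology is the coarsest topology on \<open>H1\<close> making all continuous linear functionals
  continuous.  Lower semicontinuity with respect to it implies the sequential version.
\<close>

definition weak_H1 :: "(real \<Rightarrow> real ^ 'n::finite) topology" where
  "weak_H1 = topology_generated_by {{w \<in> H1. l w \<in> U} | l U. l \<in> H1_dual \<and> open U}"

definition lower_semicontinuous_map :: "'a topology \<Rightarrow> ('a \<Rightarrow> 'b::linorder) \<Rightarrow> bool" where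
  "lower_semicontinuous_map X f \<longleftrightarrow> (\<forall>r. openin X {x \<in> topspace X. r < f x})"


section \<open>Dynamical and static cost\<close>

text \<open>
  For \<open>a > 1\<close> and \<open>x\<close> on the boundary, the Lagrangian is only meaningful for tangent \<open>q\<close>.  The
  value given to non-tangent \<open>q\<close> is immaterial, because the velocity of a curve in
  \<open>H1_halfspace k\<close> is tangent at almost every time at which the curve is on the boundary.
\<close>

definition lagrangian :: "'n::finite \<Rightarrow> real \<Rightarrow> real ^ 'n \<Rightarrow> real ^ 'n \<Rightarrow> real" where
  "lagrangian k a x q =
     (if 1 < a \<and> x \<in> bdry k then 1 / (2 * a) * (norm q)\<^sup>2 else 1 / 2 * (norm q)\<^sup>2)"

definition action :: "'n::finite \<Rightarrow> real \<Rightarrow> (real \<Rightarrow> real ^ 'n) \<Rightarrow> ennreal" where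
  "action k a w = (\<integral>\<^sup>+t\<in>{0..1}. ennreal (lagrangian k a (w t) (velocity w t)) \<partial>lborel)"

definition dyn_cost :: "'n::finite \<Rightarrow> real \<Rightarrow> (real \<Rightarrow> real ^ 'n) \<Rightarrow> ennreal" where
  "dyn_cost k a w = (if w \<in> H1 then action k a w else \<infinity>)"

definition conn :: "'n::finite \<Rightarrow> real ^ 'n \<Rightarrow> real ^ 'n \<Rightarrow> (real \<Rightarrow> real ^ 'n) set" where
  "conn k x y = {w \<in> H1_halfspace k. w 0 = x \<and> w 1 = y}"

definition geodesic ::
    "'n::finite \<Rightarrow> real \<Rightarrow> real ^ 'n \<Rightarrow> real ^ 'n \<Rightarrow> (real \<Rightarrow> real ^ 'n) \<Rightarrow> bool" where
  "geodesic k a x y g \<longleftrightarrow> g \<in> conn k x y \<and> (\<forall>w\<in>conn k x y. action k a g \<le> action k a w)"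

definition threshold :: "'n::finite \<Rightarrow> real \<Rightarrow> real ^ 'n \<Rightarrow> real ^ 'n \<Rightarrow> real" where
  "threshold k a x y =
     1 / sqrt (a - 1) * (\<bar>x $ k + y $ k\<bar> + 2 * sqrt a * sqrt (x $ k * y $ k))"

definition frakC :: "'n::finite \<Rightarrow> real \<Rightarrow> ((real ^ 'n) \<times> (real ^ 'n)) set" where
  "frakC k a = {(x, y). x \<in> halfspace k \<and> y \<in> halfspace k \<and>
                        norm (tang k y - tang k x) \<le> threshold k a x y}"

definition static_cost :: "'n::finite \<Rightarrow> real \<Rightarrow> real ^ 'n \<Rightarrow> real ^ 'n \<Rightarrow> real" where
  "static_cost k a x y =
     (if a \<le> 1 then 1 / 2 * (norm (x - y))\<^sup>2
      else if (x, y) \<in> frakC k a then 1 / 2 * (norm (x - y))\<^sup>2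
      else 1 / (2 * a) *
             (sqrt (a - 1) * \<bar>x $ k + y $ k\<bar> + norm (tang k y - tang k x))\<^sup>2)"

text \<open>
  Pairs of interior points for which the inequality in \<open>frakC\<close> is an equality.  With
  \<open>r = \<bar>y' - x'\<bar>\<close> and \<open>s = x\<^sub>1 + y\<^sub>1\<close>, the two expressions for the cost satisfy
  \<open>a (\<bar>x - y\<bar>\<^sup>2) - (sqrt (a - 1) s + r)\<^sup>2 = (sqrt (a - 1) r - s)\<^sup>2 - 4 a x\<^sub>1 y\<^sub>1\<close>,
  which vanishes for these pairs: the straight line and the broken line through the boundary
  are then two different minimizers, and uniqueness of the geodesic fails.  If \<open>x\<^sub>1 = 0\<close> or
  \<open>y\<^sub>1 = 0\<close> and equality holds, the two curves coincide.
\<close>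

definition cut_pairs :: "'n::finite \<Rightarrow> real \<Rightarrow> ((real ^ 'n) \<times> (real ^ 'n)) set" where
  "cut_pairs k a = {(x, y). 1 < a \<and> 0 < x $ k \<and> 0 < y $ k \<and>
                            norm (tang k y - tang k x) = threshold k a x y}"


section \<open>Broken lines through the boundary\<close>

definition z_in :: "'n::finite \<Rightarrow> real \<Rightarrow> real ^ 'n \<Rightarrow> real ^ 'n \<Rightarrow> real ^ 'n" where
  "z_in k \<alpha> x y = tang k x + (x $ k * tan \<alpha>) *\<^sub>R sgn (tang k y - tang k x)"

definition z_out :: "'n::finite \<Rightarrow> real \<Rightarrow> real ^ 'n \<Rightarrow> real ^ 'n \<Rightarrow> real ^ 'n" where
  "z_out k \<alpha> x y = tang k y - (y $ k * tan \<alpha>) *\<^sub>R sgn (tang k y - tang k x)"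

text \<open>
  The curve \<open>g\<close> runs along the segment from \<open>p\<close> to \<open>q\<close> at constant speed during the time interval
  from \<open>s\<close> to \<open>u\<close>; for \<open>s = u\<close> this forces \<open>p = q\<close>.
\<close>

definition straight_on ::
    "(real \<Rightarrow> real ^ 'n::finite) \<Rightarrow> real \<Rightarrow> real \<Rightarrow> real ^ 'n \<Rightarrow> real ^ 'n \<Rightarrow> bool" where
  "straight_on g s u p q \<longleftrightarrow> (\<forall>\<theta>\<in>{0..1}. g (linepath s u \<theta>) = linepath p q \<theta>)"

definition three_segments ::
    "'n::finite \<Rightarrow> real \<Rightarrow> real ^ 'n \<Rightarrow> real ^ 'n \<Rightarrow> (real \<Rightarrow> real ^ 'n) \<Rightarrow> bool" where
  "three_segments k \<alpha> x y g \<longleftrightarrow>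
     (\<exists>t1 t2. 0 \<le> t1 \<and> t1 \<le> t2 \<and> t2 \<le> 1 \<and>
        straight_on g 0 t1 x (z_in k \<alpha> x y) \<and>
        straight_on g t1 t2 (z_in k \<alpha> x y) (z_out k \<alpha> x y) \<and>
        straight_on g t2 1 (z_out k \<alpha> x y) y)"

end

theory Submission
  imports Defs
begin

text \<open>
  With \<open>b = max 1 a\<close> the Lagrangian is \<open>\<bar>q\<bar>\<^sup>2 / (2 b)\<close> on the boundary and \<open>\<bar>q\<bar>\<^sup>2 / 2\<close> inside, for all \<open>a\<close>.

  Lower semicontinuity at \<open>w\<close>: replace the weight \<open>1 / 2\<close> by \<open>1 / (2 b)\<close> wherever \<open>w\<close> is closer than \<open>\<delta>\<close>
  to the boundary.  The resulting functional is convex in the velocity, tends to the action of \<open>w\<close>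
  as \<open>\<delta>\<close> tends to \<open>0\<close>, and bounds the action of \<open>u\<close> from below for every \<open>u\<close> uniformly close to
  \<open>w\<close>.  Among curves of bounded action, uniform closeness follows from closeness at finitely many
  times, so a weak neighbourhood given by finitely many functionals suffices.

  Geodesics: a curve that avoids the boundary costs at least as much as the straight line.  For a
  curve that meets it, let \<open>t\<^sub>1\<close> and \<open>t\<^sub>2\<close> be the first and the last contact time.  Comparing the
  velocity with a constant vector on each of the three time intervals gives a lower bound with an
  exact quadratic remainder.  Hence a minimizer has exactly these constant velocities, and the
  contact times are then determined by the end points.
\<close>

section \<open>Curves with square integrable velocity\<close>

text \<open>For \<open>a > 1\<close> the Lagrangian jumps down at the boundary, so the cost is not
  convex in the curve. Freezing the weight along \<open>w\<close> restores convexity, but gives a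
  lower bound only for competitors kept off the boundary wherever \<open>w\<close> has a margin.
  Since the weak topology of \<open>H1\<close> is not first countable, this is secured on a
  neighbourhood and not along a sequence; the energy bound comes from the fact that a competitor
  violating the claim has bounded action.

  For geodesics the calibration yields \<open>M^2 / 2\<close> with \<open>M = p r + q s\<close>,
  where \<open>r = |y' - x'|\<close> and \<open>s = x $ k + y $ k\<close>, under the constraints
  \<open>p^2 a \<le> 1\<close> and \<open>p^2 + q^2 \<le> 1\<close>. Maximising \<open>M\<close>
  explains the two choices that occur: the unit vector along \<open>(r, s)\<close> if it is
  admissible, that is if \<open>sqrt (a - 1) r \<le> s\<close>, and otherwise the corner
  \<open>p = 1 / sqrt a\<close>, \<open>q = sqrt (a - 1) / sqrt a\<close>, the sine and cosine of
  \<open>\<alpha>\<close>. At the corner the broken line attains the bound; for flatter chords its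
  boundary segment would run backwards, and the straight line costs no more than any curve with
  contact.\<close>

definition square_integrable :: "(real \<Rightarrow> real ^ 'n::finite) \<Rightarrow> bool" where
  "square_integrable v \<longleftrightarrow> set_borel_measurable lborel {0..1} v \<and>
     set_integrable lborel {0..1} (\<lambda>t. (norm (v t))\<^sup>2)"

lemma has_velocity_iff:
  "has_velocity w v \<longleftrightarrow>
     square_integrable v \<and> (\<forall>t\<in>{0..1}. w t = w 0 + (LINT s:{0..t}|lborel. v s))"
  by (auto simp: has_velocity_def square_integrable_def)

lemma has_velocity_square_integrable: "has_velocity w v \<Longrightarrow> square_integrable v"
  unfolding has_velocity_iff by (rule conjunct1)

lemma has_velocity_eq:
  "has_velocity w v \<Longrightarrow> t \<in> {0..1} \<Longrightarrow> w t = w 0 + (LINT s:{0..t}|lborel. v s)"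
  unfolding has_velocity_iff by blast

lemma has_velocityI:
  assumes "square_integrable v" "\<And>t. t \<in> {0..1} \<Longrightarrow> w t = w 0 + (LINT s:{0..t}|lborel. v s)"
  shows "has_velocity w v"
  using assms unfolding has_velocity_iff by blast

lemma set_integrable_const_unit_interval [simp]:
  "set_integrable lborel {0..1::real} (\<lambda>t. c :: 'a::{banach, second_countable_topology})"
  unfolding set_integrable_def by (intro integrable_scaleR_left integrable_real_indicator) auto

lemma set_integral_const_interval:
  fixes c :: "'a::{banach, second_countable_topology}"
  assumes "s \<le> t"
  shows "(LINT r:{s..t}|lborel. c) = (t - s) *\<^sub>R c"
  using assms by (subst set_integral_const) auto

lemma square_integrable_inner:
  assumes "square_integrable u" "square_integrable v"
  shows "set_integrable lborel {0..1} (\<lambda>t. u t \<bullet> v t)"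
proof -
  have m: "set_borel_measurable lborel {0..1} (\<lambda>t. u t \<bullet> v t)"
  proof -
    \<comment> \<open>Measurability is assumed only after cutting off to \<open>{0..1}\<close>. The
      indicator is idempotent, so it may be attached to both factors.\<close>
    have "(\<lambda>t. indicator {0..1} t *\<^sub>R (u t \<bullet> v t)) =
        (\<lambda>t. (indicator {0..1} t *\<^sub>R u t) \<bullet> (indicator {0..1} t *\<^sub>R v t))"
      by (auto simp: fun_eq_iff split: split_indicator)
    moreover have "\<dots> \<in> borel_measurable lborel"
      using assms by (intro borel_measurable_inner) (auto simp: square_integrable_def set_borel_measurable_def)
    ultimately show ?thesis by (simp add: set_borel_measurable_def)
  qed
  have "set_integrable lborel {0..1} (\<lambda>t. (norm (u t))\<^sup>2 + (norm (v t))\<^sup>2)"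
    using assms by (intro set_integral_add) (auto simp: square_integrable_def)
  then show ?thesis
  proof (rule set_integrable_bound[OF _ m])
    show "AE t in lborel. t \<in> {0..1} \<longrightarrow> norm (u t \<bullet> v t) \<le> norm ((norm (u t))\<^sup>2 + (norm (v t))\<^sup>2)"
    proof (intro AE_I2 impI)
      fix t
      have "\<bar>u t \<bullet> v t\<bar> \<le> norm (u t) * norm (v t)" by (rule Cauchy_Schwarz_ineq2)
      also have "\<dots> \<le> (norm (u t))\<^sup>2 + (norm (v t))\<^sup>2"
        using sum_squares_bound[of "norm (u t)" "norm (v t)"]
          mult_nonneg_nonneg[OF norm_ge_zero[of "u t"] norm_ge_zero[of "v t"]] by linarith
      finally show "norm (u t \<bullet> v t) \<le> norm ((norm (u t))\<^sup>2 + (norm (v t))\<^sup>2)" by simp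
    qed
  qed
qed

lemma square_integrable_norm_sq:
  "square_integrable v \<Longrightarrow> set_integrable lborel {0..1} (\<lambda>t. (norm (v t))\<^sup>2)"
  by (simp add: square_integrable_def)

lemma square_integrable_add:
  assumes "square_integrable u" "square_integrable v"
  shows "square_integrable (\<lambda>t. u t + v t)"
proof -
  have "set_integrable lborel {0..1} (\<lambda>t. (norm (u t))\<^sup>2 + (norm (v t))\<^sup>2 + 2 * (u t \<bullet> v t))"
    using assms by (intro set_integral_add set_integrable_mult_right square_integrable_norm_sq square_integrable_inner) auto
  moreover have "(norm (x + y))\<^sup>2 = (norm x)\<^sup>2 + (norm y)\<^sup>2 + 2 * (x \<bullet> y)" for x y :: "real ^ 'a"
    by (simp add: power2_norm_eq_inner inner_simps inner_commute)
  ultimately show ?thesis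
    using assms unfolding square_integrable_def set_borel_measurable_def
    by (auto simp: scaleR_add_right)
qed

lemma square_integrable_weight:
  assumes "square_integrable v" "h \<in> borel_measurable borel" "\<And>t. \<bar>h t\<bar> \<le> B"
  shows "square_integrable (\<lambda>t. h t *\<^sub>R v t)"
  unfolding square_integrable_def
proof
  have eq: "(\<lambda>t. indicator {0..1} t *\<^sub>R (h t *\<^sub>R v t)) = (\<lambda>t. h t *\<^sub>R (indicator {0..1} t *\<^sub>R v t))"
    by (auto simp: fun_eq_iff)
  show *: "set_borel_measurable lborel {0..1} (\<lambda>t. h t *\<^sub>R v t)"
    unfolding set_borel_measurable_def eq
    by (rule borel_measurable_scaleR)
      (use assms in \<open>simp_all add: square_integrable_def set_borel_measurable_def\<close>)
  have "set_integrable lborel {0..1::real} (\<lambda>t. B\<^sup>2 * (norm (v t))\<^sup>2)"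
    using assms by (intro set_integrable_mult_right) (auto simp: square_integrable_def)
  then show "set_integrable lborel {0..1} (\<lambda>t. (norm (h t *\<^sub>R v t))\<^sup>2)"
  proof (rule set_integrable_bound)
    have eq: "(\<lambda>t. indicat_real {0..1} t *\<^sub>R (norm (h t *\<^sub>R v t))\<^sup>2) =
       (\<lambda>t. (norm (indicat_real {0..1} t *\<^sub>R (h t *\<^sub>R v t)))\<^sup>2)"
      by (auto simp: fun_eq_iff split: split_indicator)
    show "set_borel_measurable lborel {0..1} (\<lambda>t. (norm (h t *\<^sub>R v t))\<^sup>2)"
      unfolding set_borel_measurable_def eq
      using borel_measurable_power[OF measurable_compose[OF *[unfolded set_borel_measurable_def] borel_measurable_norm], of 2] .
    show "AE t in lborel. t \<in> {0..1} \<longrightarrow> norm ((norm (h t *\<^sub>R v t))\<^sup>2) \<le> norm (B\<^sup>2 * (norm (v t))\<^sup>2)"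
    proof (intro AE_I2 impI)
      fix t
      have "(h t)\<^sup>2 \<le> B\<^sup>2"
        using power_mono[OF assms(3)[of t], of 2] by simp
      then show "norm ((norm (h t *\<^sub>R v t))\<^sup>2) \<le> norm (B\<^sup>2 * (norm (v t))\<^sup>2)"
        by (simp add: power_mult_distrib mult_right_mono)
    qed
  qed
qed

lemma square_integrable_scaleR:
  assumes "square_integrable v"
  shows "square_integrable (\<lambda>t. c *\<^sub>R v t)"
  by (rule square_integrable_weight[OF assms, of _ "\<bar>c\<bar>"]) auto

lemma square_integrable_diff:
  assumes "square_integrable u" "square_integrable v"
  shows "square_integrable (\<lambda>t. u t - v t)"
  using square_integrable_add[OF assms(1) square_integrable_scaleR[OF assms(2), of "-1"]] by simp

lemma square_integrable_bounded:
  assumes "v \<in> borel_measurable borel" "\<And>t. norm (v t) \<le> B"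
  shows "square_integrable v"
  unfolding square_integrable_def
proof
  show *: "set_borel_measurable lborel {0..1} v"
    unfolding set_borel_measurable_def using assms(1) by measurable
  have "set_integrable lborel {0..1::real} (\<lambda>t. B\<^sup>2)" by simp
  then show "set_integrable lborel {0..1} (\<lambda>t. (norm (v t))\<^sup>2)"
  proof (rule set_integrable_bound)
    show "set_borel_measurable lborel {0..1} (\<lambda>t. (norm (v t))\<^sup>2)"
      unfolding set_borel_measurable_def using assms(1) by measurable
    show "AE t in lborel. t \<in> {0..1} \<longrightarrow> norm ((norm (v t))\<^sup>2) \<le> norm (B\<^sup>2)"
      using assms(2) by (auto intro!: AE_I2 power_mono)
  qed
qed

lemma square_integrable_const [simp]: "square_integrable (\<lambda>t. c)"
  by (rule square_integrable_bounded[of _ "norm c"]) auto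

lemma square_integrable_imp_integrable:
  assumes "square_integrable v"
  shows "set_integrable lborel {0..1} v"
proof -
  have "set_integrable lborel {0..1} (\<lambda>t. 1 + (norm (v t))\<^sup>2)"
    using assms by (intro set_integral_add) (auto simp: square_integrable_def)
  then show ?thesis
  proof (rule set_integrable_bound)
    show "set_borel_measurable lborel {0..1} v" using assms by (simp add: square_integrable_def)
    show "AE t in lborel. t \<in> {0..1} \<longrightarrow> norm (v t) \<le> norm (1 + (norm (v t))\<^sup>2)"
    proof (intro AE_I2 impI)
      fix t
      show "norm (v t) \<le> norm (1 + (norm (v t))\<^sup>2)"
        using sum_squares_bound[of 1 "norm (v t)"] norm_ge_zero[of "v t"]
        unfolding real_norm_def power_one mult_1_right by arith
    qed
  qed
qed

lemma set_integrable_subinterval: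
  fixes f :: "real \<Rightarrow> 'a::{banach, second_countable_topology}"
  assumes "set_integrable lborel {0..1} f" "0 \<le> s" "t \<le> 1"
  shows "set_integrable lborel {s..t} f"
  by (rule set_integrable_subset[OF assms(1)]) (use assms in auto)

lemma set_integral_combine:
  fixes f :: "real \<Rightarrow> 'a::euclidean_space"
  assumes "set_integrable lborel {r..t} f" "r \<le> s" "s \<le> t"
  shows "(LINT x:{r..t}|lborel. f x) = (LINT x:{r..s}|lborel. f x) + (LINT x:{s..t}|lborel. f x)"
proof -
  have i: "set_integrable lborel {r..s} f" "set_integrable lborel {s..t} f"
    by (rule set_integrable_subset[OF assms(1)]; use assms in auto)+
  show ?thesis
    using Henstock_Kurzweil_Integration.integral_combine[OF assms(2,3) set_borel_integral_eq_integral(1)[OF assms(1)]]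
    by (simp add: set_borel_integral_eq_integral(2) assms i)
qed

text \<open>The rays \<open>{..t}\<close> are stable under intersection and generate the Borel sets.
  Dynkin induction thus makes the integral of \<open>f\<close> vanish over every Borel set, and then
  \<open>f\<close> vanishes almost everywhere. The total integral enters in the complement
  step.\<close>

lemma AE_zero_if_initial_integrals_zero:
  fixes f :: "real \<Rightarrow> 'a::{banach, second_countable_topology}"
  assumes f: "integrable lborel f" and z: "\<And>t. (LINT s:{..t}|lborel. f s) = 0" and z1: "(LINT s|lborel. f s) = 0"
  shows "AE t in lborel. f t = 0"
proof (rule sigma_finite_measure.density_zero[OF sigma_finite_lborel f])
  have *: "sets (borel :: real measure) = sigma_sets UNIV (range atMost)"
    by (subst borel_eq_atMost) simp
  have si: "set_integrable lborel A f" if "A \<in> sets borel" for A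
    using that f unfolding set_integrable_def by (intro integrable_mult_indicator) auto
  fix A :: "real set" assume "A \<in> sets lborel"
  then have "A \<in> sigma_sets UNIV (range atMost)" by (simp add: *)
  from _ _ this show "(LINT s:A|lborel. f s) = 0"
  proof (rule sigma_sets_induct_disjoint)
    show "Int_stable (range (atMost :: real \<Rightarrow> _))"
      by (auto simp: Int_stable_def)
  next
    fix A :: "real set" assume A: "A \<in> sigma_sets UNIV (range atMost)" and "(LINT s:A|lborel. f s) = 0"
    moreover have "(LINT s:A \<union> (UNIV - A)|lborel. f s) = (LINT s:A|lborel. f s) + (LINT s:(UNIV-A)|lborel. f s)"
      using A by (intro set_integral_Un si) (auto simp: *[symmetric])
    ultimately show "(LINT s:UNIV-A|lborel. f s) = 0"
      using z1 by (simp add: set_lebesgue_integral_def)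
  next
    fix A :: "nat \<Rightarrow> real set" assume A: "disjoint_family A" "range A \<subseteq> sigma_sets UNIV (range atMost)"
      and "\<And>i. (LINT s:A i|lborel. f s) = 0"
    moreover have "(LINT s:(\<Union>i. A i)|lborel. f s) = (\<Sum>i. LINT s:A i|lborel. f s)"
      using A by (intro lebesgue_integral_countable_add si) (auto simp: *[symmetric] disjoint_family_on_def)
    ultimately show "(LINT s:(\<Union>i. A i)|lborel. f s) = 0" by simp
  next
    show "(LINT s:{}|lborel. f s) = 0" by (simp add: set_lebesgue_integral_def)
  qed (use z in auto)
qed

lemma has_velocity_diff:
  assumes "has_velocity w v" "0 \<le> s" "s \<le> t" "t \<le> 1"
  shows "w t - w s = (LINT r:{s..t}|lborel. v r)"
proof -
  have "set_integrable lborel {0..t} v"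
    using assms(3,4)
    by (intro set_integrable_subinterval[OF square_integrable_imp_integrable
          [OF has_velocity_square_integrable[OF assms(1)]]]) auto
  from set_integral_combine[OF this assms(2,3)]
  have "(LINT r:{0..t}|lborel. v r) = (LINT r:{0..s}|lborel. v r) + (LINT r:{s..t}|lborel. v r)" .
  moreover have "w t = w 0 + (LINT r:{0..t}|lborel. v r)" "w s = w 0 + (LINT r:{0..s}|lborel. v r)"
    by (rule has_velocity_eq[OF assms(1)]; use assms in auto)+
  ultimately show ?thesis by simp
qed

text \<open>Makes the arbitrary choice in \<open>velocity\<close> harmless: integrals may be
  computed with any velocity at hand, such as the explicit one of a line or of a broken
  path.\<close>

lemma has_velocity_unique:
  assumes "has_velocity w u" "has_velocity w v"
  shows "AE t in lborel. t \<in> {0..1} \<longrightarrow> u t = v t"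
proof -
  let ?f = "\<lambda>t. indicator {0..1} t *\<^sub>R (u t - v t)"
  have i: "set_integrable lborel {0..1} u" "set_integrable lborel {0..1} v"
    by (rule square_integrable_imp_integrable[OF has_velocity_square_integrable], fact)+
  have d: "set_integrable lborel {0..1} (\<lambda>t. u t - v t)"
    using i by auto
  have z: "(LINT s:{0..t}|lborel. (u s - v s)) = 0" if "t \<in> {0..1}" for t
  proof -
    have "set_integrable lborel {0..t} u" "set_integrable lborel {0..t} v"
      using i that by (auto intro: set_integrable_subinterval[of _ 0 t])
    then have "(LINT s:{0..t}|lborel. (u s - v s)) = (LINT s:{0..t}|lborel. u s) - (LINT s:{0..t}|lborel. v s)"
      by (rule set_integral_diff)
    then show ?thesis
      using has_velocity_diff[OF assms(1), of 0 t] has_velocity_diff[OF assms(2), of 0 t] that by simp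
  qed
  \<comment> \<open>Extending the difference by zero to the whole line turns its integral over a ray
    into one over an initial part of \<open>{0..1}\<close>.\<close>
  have eq: "(LINT s:{..t}|lborel. ?f s) = (if t < 0 then 0 else LINT s:{0..min t 1}|lborel. (u s - v s))" for t
  proof (cases "t < 0")
    case True
    then have eq: "(\<lambda>s. indicat_real {..t} s *\<^sub>R ?f s) = (\<lambda>s. 0)"
      by (auto simp: fun_eq_iff split: split_indicator)
    show ?thesis
      unfolding set_lebesgue_integral_def eq using True by simp
  next
    case False
    then have eq: "(\<lambda>s. indicat_real {..t} s *\<^sub>R ?f s) =
        (\<lambda>s. indicator {0..min t 1} s *\<^sub>R (u s - v s))"
      by (auto simp: fun_eq_iff split: split_indicator)
    show ?thesis
      unfolding set_lebesgue_integral_def eq using False by simp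
  qed
  have "AE t in lborel. ?f t = 0"
  proof (rule AE_zero_if_initial_integrals_zero)
    show "integrable lborel ?f" using d by (simp add: set_integrable_def)
    show "(LINT s:{..t}|lborel. ?f s) = 0" for t
      using z by (simp add: eq)
    show "(LINT s|lborel. ?f s) = 0" using z[of 1] by (simp add: set_lebesgue_integral_def)
  qed
  then show ?thesis by eventually_elim (auto split: split_indicator_asm)
qed

lemma has_velocity_velocity: "w \<in> H1 \<Longrightarrow> has_velocity w (velocity w)"
  unfolding H1_def velocity_def by (simp add: someI_ex)

lemma has_velocity_imp_H1: "has_velocity w v \<Longrightarrow> w \<in> H1"
  unfolding H1_def by auto

lemma AE_velocity:
  assumes "has_velocity w v"
  shows "AE t in lborel. t \<in> {0..1} \<longrightarrow> velocity w t = v t"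
  by (rule has_velocity_unique[OF has_velocity_velocity assms]) (rule has_velocity_imp_H1[OF assms])

lemma has_velocity_add:
  assumes "has_velocity w v" "has_velocity w' v'"
  shows "has_velocity (\<lambda>t. w t + w' t) (\<lambda>t. v t + v' t)"
proof -
  have i: "set_integrable lborel {0..1} v" "set_integrable lborel {0..1} v'"
    by (rule square_integrable_imp_integrable[OF has_velocity_square_integrable], fact)+
  have "w t + w' t = w 0 + w' 0 + (LINT s:{0..t}|lborel. v s + v' s)" if t: "t \<in> {0..1}" for t
  proof -
    have "set_integrable lborel {0..t} v" "set_integrable lborel {0..t} v'"
      using i t by (auto intro: set_integrable_subinterval[of _ 0 t])
    then have "(LINT s:{0..t}|lborel. v s + v' s) = (LINT s:{0..t}|lborel. v s) + (LINT s:{0..t}|lborel. v' s)"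
      by (rule set_integral_add(2))
    with has_velocity_eq[OF assms(1) t] has_velocity_eq[OF assms(2) t] show ?thesis by simp
  qed
  with square_integrable_add[OF assms[THEN has_velocity_square_integrable]] show ?thesis
    by (rule has_velocityI)
qed

lemma has_velocity_scaleR:
  assumes "has_velocity w v"
  shows "has_velocity (\<lambda>t. c *\<^sub>R w t) (\<lambda>t. c *\<^sub>R v t)"
proof -
  have "c *\<^sub>R w t = c *\<^sub>R w 0 + (LINT s:{0..t}|lborel. c *\<^sub>R v s)" if "t \<in> {0..1}" for t
    by (subst has_velocity_eq[OF assms that]) (simp add: scaleR_add_right)
  with square_integrable_scaleR[OF has_velocity_square_integrable[OF assms]] show ?thesis
    by (rule has_velocityI)
qed

text \<open>Completes the square, \<open>|v|^2 = 2 c.v - |c|^2 + |v - c|^2\<close>; the linear term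
  depends only on the increment of the curve. If \<open>c\<close> is the mean velocity, the first
  two terms are the energy of uniform motion and the last one is the exact excess over it.\<close>

lemma set_integral_norm_sq_expand:
  assumes v: "square_integrable v" and "0 \<le> s" "s \<le> t" "t \<le> 1"
  shows "(LINT r:{s..t}|lborel. (norm (v r))\<^sup>2) =
     2 * (c \<bullet> (LINT r:{s..t}|lborel. v r)) - (t - s) * (norm c)\<^sup>2
     + (LINT r:{s..t}|lborel. (norm (v r - c))\<^sup>2)"
proof -
  have c: "square_integrable (\<lambda>r. c)" by simp
  note sub = set_integrable_subinterval[OF _ assms(2,4)]
  note i = sub[OF square_integrable_imp_integrable[OF v]]
    sub[OF set_integrable_const_unit_interval[of c]]
    sub[OF set_integrable_const_unit_interval[of "(norm c)\<^sup>2"]]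
    sub[OF square_integrable_norm_sq[OF v]]
    sub[OF square_integrable_norm_sq[OF square_integrable_diff[OF v c]]]
    sub[OF square_integrable_inner[OF c v]]
  have "(LINT r:{s..t}|lborel. (norm (v r))\<^sup>2) =
    (LINT r:{s..t}|lborel. 2 * (c \<bullet> v r) - (norm c)\<^sup>2 + (norm (v r - c))\<^sup>2)"
    by (rule set_lebesgue_integral_cong) (auto simp: power2_norm_eq_inner inner_simps inner_commute)
  also have "\<dots> = 2 * (LINT r:{s..t}|lborel. c \<bullet> v r) - (t - s) * (norm c)\<^sup>2
     + (LINT r:{s..t}|lborel. (norm (v r - c))\<^sup>2)"
    using i assms by (simp add: set_integral_diff set_integral_add set_integral_const_interval)
  also have "(LINT r:{s..t}|lborel. c \<bullet> v r) = c \<bullet> (LINT r:{s..t}|lborel. v r)"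
    using integral_inner_right[of c lborel "\<lambda>r. indicator {s..t} r *\<^sub>R v r"] i(1)
    by (simp add: set_lebesgue_integral_def set_integrable_def)
  finally show ?thesis .
qed

section \<open>Integral inequalities and Hoelder continuity of curves\<close>

lemma set_integral_AE_cong:
  fixes f g :: "'a \<Rightarrow> 'b::{banach, second_countable_topology}"
  assumes "set_integrable M A f" "set_integrable M A g" "AE t in M. t \<in> A \<longrightarrow> f t = g t"
  shows "(LINT t:A|M. f t) = (LINT t:A|M. g t)"
  unfolding set_lebesgue_integral_def
proof (rule integral_cong_AE)
  show "AE t in M. indicator A t *\<^sub>R f t = indicator A t *\<^sub>R g t"
    using assms(3) by eventually_elim (auto split: split_indicator)
qed (use assms in \<open>auto simp: set_integrable_def\<close>)

lemma set_integral_nonneg: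
  fixes f :: "'a \<Rightarrow> real"
  assumes "\<And>t. t \<in> A \<Longrightarrow> 0 \<le> f t"
  shows "0 \<le> (LINT t:A|M. f t)"
  unfolding set_lebesgue_integral_def
  by (rule integral_nonneg_AE, rule AE_I2) (auto simp: assms split: split_indicator)

lemma set_nn_integral_eq_set_integral:
  fixes f :: "'a \<Rightarrow> real"
  assumes "set_integrable M A f" "\<And>t. t \<in> A \<Longrightarrow> 0 \<le> f t"
  shows "(\<integral>\<^sup>+t\<in>A. ennreal (f t) \<partial>M) = ennreal (LINT t:A|M. f t)"
proof -
  have "(\<integral>\<^sup>+t\<in>A. ennreal (f t) \<partial>M) = (\<integral>\<^sup>+t. ennreal (indicator A t *\<^sub>R f t) \<partial>M)"
    by (rule nn_integral_cong) (auto split: split_indicator)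
  also have "\<dots> = ennreal (LINT t:A|M. f t)"
    unfolding set_lebesgue_integral_def
    using assms by (intro nn_integral_eq_integral) (auto simp: set_integrable_def split: split_indicator)
  finally show ?thesis .
qed

lemma set_integral_subinterval_mono:
  fixes f :: "real \<Rightarrow> real"
  assumes "set_integrable lborel {0..1} f" "\<And>t. 0 \<le> f t" "0 \<le> s" "t \<le> 1"
  shows "(LINT r:{s..t}|lborel. f r) \<le> (LINT r:{0..1}|lborel. f r)"
  unfolding set_lebesgue_integral_def
proof (rule integral_mono)
  show "indicat_real {s..t} x *\<^sub>R f x \<le> indicat_real {0..1} x *\<^sub>R f x" for x
    using assms by (auto split: split_indicator)
qed (use assms(1) set_integrable_subinterval[OF assms(1,3,4)] in \<open>simp_all add: set_integrable_def\<close>)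

text \<open>The quadratic polynomial \<open>c \<mapsto> ?A - 2 * c * ?B + c^2 * ?C\<close> is
  nonnegative; for \<open>?C > 0\<close> it is evaluated at its vertex
  \<open>?B / ?C\<close>.\<close>

lemma integral_inner_Cauchy_Schwarz:
  assumes u: "square_integrable u" and v: "square_integrable v"
  shows "\<bar>LINT t:{0..1}|lborel. u t \<bullet> v t\<bar> \<le>
     sqrt (LINT t:{0..1}|lborel. (norm (u t))\<^sup>2) * sqrt (LINT t:{0..1}|lborel. (norm (v t))\<^sup>2)"
proof -
  let ?A = "LINT t:{0..1}|lborel. (norm (u t))\<^sup>2"
  let ?B = "LINT t:{0..1}|lborel. u t \<bullet> v t"
  let ?C = "LINT t:{0..1}|lborel. (norm (v t))\<^sup>2"
  have quad: "0 \<le> ?A - 2 * c * ?B + c\<^sup>2 * ?C" for c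
  proof -
    have "0 \<le> (LINT t:{0..1}|lborel. (norm (u t - c *\<^sub>R v t))\<^sup>2)"
      by (rule set_integral_nonneg) simp
    also have "\<dots> = (LINT t:{0..1}|lborel. (norm (u t))\<^sup>2 - (2 * c) * (u t \<bullet> v t) + c\<^sup>2 * (norm (v t))\<^sup>2)"
      by (rule set_lebesgue_integral_cong)
        (auto simp: power2_norm_eq_inner inner_simps inner_commute power2_eq_square[of c] algebra_simps)
    also have "\<dots> = ?A - 2 * c * ?B + c\<^sup>2 * ?C"
      using square_integrable_norm_sq[OF u] square_integrable_norm_sq[OF v] square_integrable_inner[OF u v]
      by (simp add: set_integral_diff set_integral_add)
    finally show ?thesis .
  qed
  have AC: "0 \<le> ?A" "0 \<le> ?C" by (auto intro: set_integral_nonneg)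
  have "?B\<^sup>2 \<le> ?A * ?C"
  proof (cases "?C = 0")
    case True
    have "?B = 0"
    proof (rule ccontr)
      assume "?B \<noteq> 0"
      \<comment> \<open>For \<open>?C = 0\<close> the polynomial is affine and takes the value
        \<open>-1\<close> at this \<open>c\<close>.\<close>
      with quad[of "(?A + 1) / (2 * ?B)"] True show False by simp
    qed
    then show ?thesis using True by simp
  next
    case False
    with AC have "0 < ?C" by simp
    then show ?thesis using quad[of "?B / ?C"] by (simp add: field_simps power2_eq_square)
  qed
  then have "sqrt (?B\<^sup>2) \<le> sqrt (?A * ?C)" by (rule real_sqrt_le_mono)
  then show ?thesis by (simp add: real_sqrt_mult)
qed

lemma energy_nonneg: "0 \<le> energy w"
  unfolding energy_def by (rule set_integral_nonneg) simp

text \<open>Around the mean velocity \<open>c\<close> the remainder of the expansion is nonnegative,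
  and the other terms equal \<open>|w t - w s|^2 / (t - s)\<close>. As the modulus of continuity
  depends on the energy alone, curves of bounded energy are equicontinuous; the semicontinuity proof
  relies on this in place of a compact embedding.\<close>

lemma H1_Hoelder:
  assumes "w \<in> H1" "s \<in> {0..1}" "t \<in> {0..1}"
  shows "(norm (w t - w s))\<^sup>2 \<le> \<bar>t - s\<bar> * energy w"
proof -
  have *: "(norm (w t - w s))\<^sup>2 \<le> (t - s) * energy w" if st: "0 \<le> s" "s < t" "t \<le> 1" for s t
  proof -
    let ?v = "velocity w" and ?d = "w t - w s"
    have v: "has_velocity w ?v" using assms(1) by (rule has_velocity_velocity)
    note sq = has_velocity_square_integrable[OF v]
    define c where "c = (1 / (t - s)) *\<^sub>R ?d"
    have c: "(t - s) *\<^sub>R c = ?d" using st by (simp add: c_def)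
    have "?d = (LINT r:{s..t}|lborel. ?v r)" using has_velocity_diff[OF v] st by simp
    then have "2 * (c \<bullet> ?d) - (t - s) * (norm c)\<^sup>2 \<le> (LINT r:{s..t}|lborel. (norm (?v r))\<^sup>2)"
      using set_integral_norm_sq_expand[OF sq, of s t c] st
        set_integral_nonneg[of "{s..t}" "\<lambda>r. (norm (?v r - c))\<^sup>2" lborel] by simp
    also have "\<dots> \<le> energy w"
      unfolding energy_def using square_integrable_norm_sq[OF sq] st
      by (intro set_integral_subinterval_mono) auto
    finally have "(t - s) * (2 * (c \<bullet> ?d) - (t - s) * (norm c)\<^sup>2) \<le> (t - s) * energy w"
      using st by (intro mult_left_mono) auto
    moreover have "(t - s) * (2 * (c \<bullet> ?d) - (t - s) * (norm c)\<^sup>2) = (norm ?d)\<^sup>2"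
      by (simp flip: c add: power2_norm_eq_inner power_mult_distrib) (simp add: power2_eq_square algebra_simps)
    ultimately show ?thesis by simp
  qed
  consider "s < t" | "s = t" | "t < s" by linarith
  then show ?thesis
    using *[of s t] *[of t s] assms by cases (auto simp: norm_minus_commute)
qed

lemma H1_continuous_on:
  assumes "w \<in> H1"
  shows "continuous_on {0..1} w"
  unfolding continuous_on_iff
proof (intro ballI allI impI)
  fix t e :: real assume t: "t \<in> {0..1}" and e: "0 < e"
  let ?E = "energy w + 1"
  have E: "0 < ?E" using energy_nonneg[of w] by linarith
  show "\<exists>d>0. \<forall>s\<in>{0..1::real}. dist s t < d \<longrightarrow> dist (w s) (w t) < e"
  proof (intro exI conjI ballI impI)
    show "0 < e\<^sup>2 / ?E" using e E by simp
    fix s assume s: "s \<in> {0..1}" "dist s t < e\<^sup>2 / ?E"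
    have "(norm (w s - w t))\<^sup>2 \<le> \<bar>s - t\<bar> * energy w" using H1_Hoelder[OF assms t s(1)] .
    also have "\<dots> \<le> \<bar>s - t\<bar> * ?E" by (intro mult_left_mono) auto
    also have "\<dots> < e\<^sup>2" using s(2) E by (simp add: dist_real_def field_simps)
    finally show "dist (w s) (w t) < e"
      using e by (simp add: dist_norm power_less_imp_less_base)
  qed
qed

section \<open>Functionals generating the weak topology\<close>

lemma H1_dual_eval:
  assumes t: "t \<in> {0..1}"
  shows "(\<lambda>w. w t $ k) \<in> H1_dual"
proof -
  have "\<bar>w t $ k\<bar> \<le> sqrt 2 * H1_norm w" if w: "w \<in> H1" for w :: "real \<Rightarrow> real ^ 'a"
  proof -
    have i: "set_integrable lborel {0..1} (\<lambda>s. (norm (w s))\<^sup>2)"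
      unfolding set_integrable_def
      by (intro borel_integrable_compact continuous_intros H1_continuous_on w) auto
    have le: "(norm (w t))\<^sup>2 \<le> 2 * (norm (w s))\<^sup>2 + 2 * energy w" if s: "s \<in> {0..1}" for s
    proof -
      have "norm (w t) \<le> norm (w s) + norm (w t - w s)" by (metis add.commute norm_triangle_sub)
      then have "(norm (w t))\<^sup>2 \<le> (norm (w s) + norm (w t - w s))\<^sup>2" by (intro power_mono) auto
      also have "\<dots> \<le> 2 * (norm (w s))\<^sup>2 + 2 * (norm (w t - w s))\<^sup>2"
        using sum_squares_bound[of "norm (w s)" "norm (w t - w s)"] by (simp add: power2_sum)
      also have "(norm (w t - w s))\<^sup>2 \<le> 1 * energy w"
        using H1_Hoelder[OF w s t] s t energy_nonneg[of w]
        by (elim order_trans) (intro mult_right_mono, auto)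
      finally show ?thesis by simp
    qed
    \<comment> \<open>Averaging over \<open>s\<close> replaces the value at a single time by the
      integral in \<open>H1_norm\<close>.\<close>
    have "(LINT s:{0..1::real}|lborel. (norm (w t))\<^sup>2)
        \<le> (LINT s:{0..1}|lborel. 2 * (norm (w s))\<^sup>2 + 2 * energy w)"
      using i le by (intro set_integral_mono) auto
    also have "\<dots> = 2 * (LINT s:{0..1}|lborel. (norm (w s))\<^sup>2) + 2 * energy w"
      using i by (simp add: set_integral_add set_integral_const_interval)
    finally have "(norm (w t))\<^sup>2 \<le> 2 * ((LINT s:{0..1}|lborel. (norm (w s))\<^sup>2) + energy w)"
      by (simp add: set_integral_const_interval)
    then have "norm (w t) \<le> sqrt (2 * ((LINT s:{0..1}|lborel. (norm (w s))\<^sup>2) + energy w))"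
      by (rule real_le_rsqrt)
    also have "\<dots> = sqrt 2 * H1_norm w" by (simp only: H1_norm_def real_sqrt_mult)
    finally show ?thesis using component_le_norm_cart[of "w t" k] by linarith
  qed
  then show ?thesis by (auto simp: H1_dual_def)
qed

text \<open>With \<open>u\<close> twice the weighted velocity of \<open>w0\<close>, this is the
  derivative at \<open>w0\<close> of the functional with frozen weight. The linear term of its
  tangent inequality thus becomes a weakly open condition.\<close>

lemma H1_dual_velocity:
  assumes u: "square_integrable u"
  shows "(\<lambda>w. LINT t:{0..1}|lborel. u t \<bullet> velocity w t) \<in> H1_dual"
proof -
  have vel: "square_integrable (velocity w)" if "w \<in> H1" for w :: "real \<Rightarrow> real ^ 'a"
    using has_velocity_square_integrable[OF has_velocity_velocity[OF that]] .
  have int: "set_integrable lborel {0..1} (\<lambda>t. u t \<bullet> velocity w t)" if "w \<in> H1" for w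
    by (rule square_integrable_inner[OF u vel[OF that]])
  \<comment> \<open>\<open>velocity\<close> is a choice, hence linear only almost everywhere; the
    integral may use any velocity instead.\<close>
  have eq: "(LINT t:{0..1}|lborel. u t \<bullet> velocity w t) = (LINT t:{0..1}|lborel. u t \<bullet> v t)"
    if "has_velocity w v" for w v
  proof (rule set_integral_AE_cong)
    show "set_integrable lborel {0..1} (\<lambda>t. u t \<bullet> velocity w t)"
      by (rule int[OF has_velocity_imp_H1[OF that]])
    show "set_integrable lborel {0..1} (\<lambda>t. u t \<bullet> v t)"
      by (rule square_integrable_inner[OF u has_velocity_square_integrable[OF that]])
    show "AE t in lborel. t \<in> {0..1} \<longrightarrow> u t \<bullet> velocity w t = u t \<bullet> v t"
      using AE_velocity[OF that] by eventually_elim simp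
  qed
  have "(LINT t:{0..1}|lborel. u t \<bullet> velocity (\<lambda>t. w t + w' t) t) =
      (LINT t:{0..1}|lborel. u t \<bullet> velocity w t) + (LINT t:{0..1}|lborel. u t \<bullet> velocity w' t)"
    if "w \<in> H1" "w' \<in> H1" for w w'
    by (simp add: eq[OF has_velocity_add[OF that[THEN has_velocity_velocity]]] inner_add_right
        set_integral_add int that)
  moreover have "(LINT t:{0..1}|lborel. u t \<bullet> velocity (\<lambda>t. c *\<^sub>R w t) t) =
      c * (LINT t:{0..1}|lborel. u t \<bullet> velocity w t)" if "w \<in> H1" for c w
    by (simp add: eq[OF has_velocity_scaleR[OF has_velocity_velocity[OF that]]])
  moreover have "\<bar>LINT t:{0..1}|lborel. u t \<bullet> velocity w t\<bar> \<le>
      sqrt (LINT t:{0..1}|lborel. (norm (u t))\<^sup>2) * H1_norm w" if "w \<in> H1" for w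
  proof -
    have "\<bar>LINT t:{0..1}|lborel. u t \<bullet> velocity w t\<bar> \<le>
        sqrt (LINT t:{0..1}|lborel. (norm (u t))\<^sup>2) * sqrt (energy w)"
      unfolding energy_def by (rule integral_inner_Cauchy_Schwarz[OF u vel[OF that]])
    also have "\<dots> \<le> sqrt (LINT t:{0..1}|lborel. (norm (u t))\<^sup>2) * H1_norm w"
      unfolding H1_norm_def
      by (intro mult_left_mono real_sqrt_le_mono real_sqrt_ge_zero set_integral_nonneg)
        (simp_all add: set_integral_nonneg)
    finally show ?thesis .
  qed
  ultimately show ?thesis unfolding H1_dual_def by blast
qed

lemma openin_weak_H1:
  assumes "l \<in> H1_dual" "open U"
  shows "openin weak_H1 {w \<in> H1. l w \<in> U}"
  unfolding weak_H1_def by (rule topology_generated_by_Basis) (use assms in blast)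

lemma topspace_weak_H1: "topspace (weak_H1 :: (real \<Rightarrow> real ^ 'n::finite) topology) = H1"
proof -
  \<comment> \<open>A generator with \<open>U = UNIV\<close> is all of \<open>H1\<close>;
    \<open>undefined\<close> is just some coordinate index.\<close>
  have "openin weak_H1 {w \<in> H1. (w :: real \<Rightarrow> real ^ 'n) 0 $ undefined \<in> UNIV}"
    by (rule openin_weak_H1[OF H1_dual_eval]) auto
  from openin_subset[OF this] have "H1 \<subseteq> topspace (weak_H1 :: (real \<Rightarrow> real ^ 'n) topology)" by simp
  moreover have "topspace (weak_H1 :: (real \<Rightarrow> real ^ 'n) topology) \<subseteq> H1"
    by (auto simp: weak_H1_def)
  ultimately show ?thesis by blast
qed

section \<open>Lower semicontinuity\<close>

text \<open>Underestimates the Lagrangian along a curve that is off the boundary at the times in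
  \<open>S\<close>: the full weight is granted only there. The parameter \<open>b\<close> stands for
  \<open>max 1 a\<close>.\<close>

definition weight :: "real \<Rightarrow> real set \<Rightarrow> real \<Rightarrow> real" where
  "weight b S t = (if t \<in> S then 1 / 2 else 1 / (2 * b))"

lemma lagrangian_eq:
  "lagrangian k a x q = (if x \<in> bdry k then 1 / (2 * max 1 a) else 1 / 2) * (norm q)\<^sup>2"
  by (auto simp: lagrangian_def max_def)

lemma weight_measurable [measurable]: "S \<in> sets borel \<Longrightarrow> weight b S \<in> borel_measurable borel"
  unfolding weight_def by (rule measurable_If_set) auto

lemma weight_bounds:
  assumes "1 \<le> b"
  shows "0 < weight b S t" "1 / (2 * b) \<le> weight b S t" "weight b S t \<le> 1 / 2"
  using assms by (auto simp: weight_def field_simps)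

lemma weight_abs_le: "1 \<le> b \<Longrightarrow> \<bar>weight b S t\<bar> \<le> 1"
  using weight_bounds[of b S t] by auto

lemma weighted_norm_sq_integrable:
  assumes "square_integrable v" "S \<in> sets borel" "1 \<le> b"
  shows "set_integrable lborel {0..1} (\<lambda>t. weight b S t * (norm (v t))\<^sup>2)"
proof -
  have "set_integrable lborel {0..1} (\<lambda>t. (weight b S t *\<^sub>R v t) \<bullet> v t)"
    by (rule square_integrable_inner[OF square_integrable_weight[OF assms(1)] assms(1)])
      (use assms weight_abs_le in auto)
  then show ?thesis by (simp add: power2_norm_eq_inner)
qed

lemma action_eq:
  assumes "has_velocity w v"
  shows "action k a w = (\<integral>\<^sup>+t\<in>{0..1}. ennreal (lagrangian k a (w t) (v t)) \<partial>lborel)"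
  unfolding action_def
proof (rule nn_integral_cong_AE)
  show "AE t in lborel. ennreal (lagrangian k a (w t) (velocity w t)) * indicator {0..1} t =
      ennreal (lagrangian k a (w t) (v t)) * indicator {0..1} t"
    using AE_velocity[OF assms] by eventually_elim (auto split: split_indicator)
qed

text \<open>Pointwise comparison. The choice of \<open>S\<close> decides the use: the empty set
  gives coercivity, a set on which the curve keeps a margin gives semicontinuity, the whole line
  serves curves without contact, and the complement of the interval from the first to the last
  contact serves touching curves.\<close>

lemma weighted_le_action:
  assumes v: "has_velocity w v" and S: "S \<in> sets borel"
    and pos: "\<And>t. t \<in> S \<Longrightarrow> t \<in> {0..1} \<Longrightarrow> w t $ k \<noteq> 0"
  shows "ennreal (LINT t:{0..1}|lborel. weight (max 1 a) S t * (norm (v t))\<^sup>2) \<le> action k a w"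
proof -
  let ?b = "max 1 a"
  have "ennreal (LINT t:{0..1}|lborel. weight ?b S t * (norm (v t))\<^sup>2) =
      (\<integral>\<^sup>+t\<in>{0..1}. ennreal (weight ?b S t * (norm (v t))\<^sup>2) \<partial>lborel)"
    using weight_bounds(1)[of ?b S]
    by (intro set_nn_integral_eq_set_integral[symmetric] weighted_norm_sq_integrable
        has_velocity_square_integrable[OF v] S) (auto intro!: mult_nonneg_nonneg simp: less_imp_le)
  also have "\<dots> \<le> (\<integral>\<^sup>+t\<in>{0..1}. ennreal (lagrangian k a (w t) (v t)) \<partial>lborel)"
  proof (rule nn_integral_mono)
    fix t
    have "weight ?b S t * (norm (v t))\<^sup>2 \<le> lagrangian k a (w t) (v t)" if "t \<in> {0..1}"
      unfolding lagrangian_eq using weight_bounds(3)[of ?b S t] pos[of t] that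
      by (intro mult_right_mono) (auto simp: weight_def bdry_def)
    then show "ennreal (weight ?b S t * (norm (v t))\<^sup>2) * indicator {0..1} t
        \<le> ennreal (lagrangian k a (w t) (v t)) * indicator {0..1} t"
      by (auto split: split_indicator intro: ennreal_leI)
  qed
  finally show ?thesis by (simp add: action_eq[OF v])
qed

lemma energy_le_action:
  assumes "w \<in> H1"
  shows "ennreal (1 / (2 * max 1 a) * energy w) \<le> action k a w"
  using weighted_le_action[OF has_velocity_velocity[OF assms], of "{}" k a]
  by (simp add: weight_def energy_def)

lemma less_action_imp_less_weighted:
  assumes w: "w \<in> H1_halfspace k" and r: "r < action k a w"
  obtains \<delta> S where "0 < \<delta>" "S \<in> sets borel" "S \<subseteq> {0..1}" "\<And>t. t \<in> S \<Longrightarrow> \<delta> \<le> w t $ k"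
    "r < ennreal (LINT t:{0..1}|lborel. weight (max 1 a) S t * (norm (velocity w t))\<^sup>2)"
proof -
  let ?b = "max 1 a" and ?v = "velocity w"
  have H: "w \<in> H1" using w by (simp add: H1_halfspace_def)
  note v = has_velocity_velocity[OF H]
  define S where "S n = {t \<in> {0..1}. 1 / real (Suc n) \<le> w t $ k}" for n
  have S: "S n \<in> sets borel" for n
  proof -
    have "closed ({0..1} \<inter> (\<lambda>t. w t $ k) -` {1 / real (Suc n)..})"
      by (rule continuous_closed_preimage) (intro continuous_intros H1_continuous_on[OF H], auto)
    moreover have "S n = {0..1} \<inter> (\<lambda>t. w t $ k) -` {1 / real (Suc n)..}" by (auto simp: S_def)
    ultimately show ?thesis by (simp add: borel_closed)
  qed
  define f where "f n t = ennreal (indicator {0..1} t *\<^sub>R (weight ?b (S n) t * (norm (?v t))\<^sup>2))" for n t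
  have mono: "S m \<subseteq> S n" if "m \<le> n" for m n
  proof -
    have "1 / real (Suc n) \<le> 1 / real (Suc m)" using that by (simp add: frac_le)
    then show ?thesis by (auto simp: S_def)
  qed
  have "incseq f"
    unfolding incseq_def le_fun_def f_def
  proof (intro allI impI ennreal_leI)
    fix m n :: nat and t assume "m \<le> n"
    then have "weight ?b (S m) t \<le> weight ?b (S n) t"
      using mono[OF \<open>m \<le> n\<close>] weight_bounds(2)[of ?b "S n" t] by (auto simp: weight_def)
    then show "indicat_real {0..1} t *\<^sub>R (weight ?b (S m) t * (norm (?v t))\<^sup>2)
        \<le> indicator {0..1} t *\<^sub>R (weight ?b (S n) t * (norm (?v t))\<^sup>2)"
      by (auto intro: mult_right_mono split: split_indicator)
  qed
  have meas: "f n \<in> borel_measurable lborel" for n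
    using weighted_norm_sq_integrable[OF has_velocity_square_integrable[OF v] S[of n], of ?b]
    unfolding f_def set_integrable_def by auto
  have "action k a w \<le> (\<integral>\<^sup>+t. (SUP n. f n t) \<partial>lborel)"
    unfolding action_def
  proof (rule nn_integral_mono)
    fix t
    show "ennreal (lagrangian k a (w t) (?v t)) * indicator {0..1} t \<le> (SUP n. f n t)"
    proof (cases "t \<in> {0..1}")
      case True
      have nn: "0 \<le> w t $ k" using w True by (auto simp: H1_halfspace_def halfspace_def)
      obtain n where n: "w t $ k \<noteq> 0 \<longrightarrow> t \<in> S n"
      proof (cases "w t $ k = 0")
        case False
        with nn obtain n where "inverse (real (Suc n)) < w t $ k"
          using reals_Archimedean[of "w t $ k"] by auto
        with True that[of n] show ?thesis by (auto simp: S_def divide_inverse)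
      qed (use that in blast)
      have "lagrangian k a (w t) (?v t) \<le> weight ?b (S n) t * (norm (?v t))\<^sup>2"
        unfolding lagrangian_eq using n weight_bounds(2)[of ?b "S n" t]
        by (intro mult_right_mono) (auto simp: weight_def bdry_def)
      with True have "ennreal (lagrangian k a (w t) (?v t)) * indicator {0..1} t \<le> f n t"
        by (auto simp: f_def intro: ennreal_leI)
      also have "\<dots> \<le> (SUP n. f n t)" by (rule SUP_upper) simp
      finally show ?thesis .
    qed simp
  qed
  also have "\<dots> = (SUP n. \<integral>\<^sup>+t. f n t \<partial>lborel)"
    by (rule nn_integral_monotone_convergence_SUP) fact+
  finally have "r < (SUP n. \<integral>\<^sup>+t. f n t \<partial>lborel)" using r by simp
  then obtain n where n: "r < (\<integral>\<^sup>+t. f n t \<partial>lborel)" by (auto simp: less_SUP_iff)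
  have "(\<integral>\<^sup>+t. f n t \<partial>lborel) = (\<integral>\<^sup>+t\<in>{0..1}. ennreal (weight ?b (S n) t * (norm (?v t))\<^sup>2) \<partial>lborel)"
    unfolding f_def by (rule nn_integral_cong) (auto split: split_indicator)
  also have "\<dots> = ennreal (LINT t:{0..1}|lborel. weight ?b (S n) t * (norm (?v t))\<^sup>2)"
    using weight_bounds(1)[of ?b "S n"]
    by (intro set_nn_integral_eq_set_integral weighted_norm_sq_integrable
        has_velocity_square_integrable[OF v] S) (auto intro!: mult_nonneg_nonneg simp: less_imp_le)
  finally have rn: "r < ennreal (LINT t:{0..1}|lborel. weight ?b (S n) t * (norm (?v t))\<^sup>2)"
    using n by simp
  show ?thesis
  proof (rule that)
    show "0 < 1 / real (Suc n)" "S n \<subseteq> {0..1}" "\<And>t. t \<in> S n \<Longrightarrow> 1 / real (Suc n) \<le> w t $ k"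
      by (auto simp: S_def)
  qed (fact S rn)+
qed

text \<open>Tangent inequality of a convex quadratic functional at \<open>u\<close>; the two sides
  differ by the integral of \<open>weight b S t * |v t - u t|^2\<close>.\<close>

lemma weighted_convex:
  assumes u: "square_integrable u" and v: "square_integrable v" and S: "S \<in> sets borel" and b: "1 \<le> b"
  shows "(LINT t:{0..1}|lborel. weight b S t * (norm (u t))\<^sup>2)
    + (LINT t:{0..1}|lborel. ((2 * weight b S t) *\<^sub>R u t) \<bullet> v t)
    - (LINT t:{0..1}|lborel. ((2 * weight b S t) *\<^sub>R u t) \<bullet> u t)
    \<le> (LINT t:{0..1}|lborel. weight b S t * (norm (v t))\<^sup>2)"
proof -
  have h: "(\<lambda>t. 2 * weight b S t) \<in> borel_measurable borel" "\<And>t. \<bar>2 * weight b S t\<bar> \<le> 2"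
    using S weight_abs_le[OF b] by (simp_all add: abs_mult)
  note m = square_integrable_weight[OF u h]
  note i = weighted_norm_sq_integrable[OF u S b] weighted_norm_sq_integrable[OF v S b]
    square_integrable_inner[OF m u] square_integrable_inner[OF m v]
  have "(LINT t:{0..1}|lborel. weight b S t * (norm (u t))\<^sup>2)
    + (LINT t:{0..1}|lborel. ((2 * weight b S t) *\<^sub>R u t) \<bullet> v t)
    - (LINT t:{0..1}|lborel. ((2 * weight b S t) *\<^sub>R u t) \<bullet> u t)
    = (LINT t:{0..1}|lborel. weight b S t * (norm (u t))\<^sup>2
      + ((2 * weight b S t) *\<^sub>R u t) \<bullet> v t - ((2 * weight b S t) *\<^sub>R u t) \<bullet> u t)"
    using i by (simp only: set_integral_diff set_integral_add)
  also have "\<dots> \<le> (LINT t:{0..1}|lborel. weight b S t * (norm (v t))\<^sup>2)"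
  proof (rule set_integral_mono)
    fix t :: real
    have "0 \<le> weight b S t * (norm (v t - u t))\<^sup>2"
      using weight_bounds(1)[OF b, of S t] by simp
    then show "weight b S t * (norm (u t))\<^sup>2 + ((2 * weight b S t) *\<^sub>R u t) \<bullet> v t
        - ((2 * weight b S t) *\<^sub>R u t) \<bullet> u t \<le> weight b S t * (norm (v t))\<^sup>2"
      by (simp add: power2_norm_eq_inner inner_simps inner_commute algebra_simps)
  qed (use i in \<open>simp_all only: set_integral_diff set_integral_add\<close>)
  finally show ?thesis .
qed

lemma dyn_cost_lower_semicontinuous:
  "lower_semicontinuous_map (subtopology weak_H1 (H1_halfspace k)) (dyn_cost k a)"
  unfolding lower_semicontinuous_map_def
proof
  fix r :: ennreal
  let ?X = "subtopology weak_H1 (H1_halfspace k)"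
  let ?b = "max 1 a"
  have sub: "H1_halfspace k \<subseteq> H1" by (auto simp: H1_halfspace_def)
  have top: "topspace ?X = H1_halfspace k"
    using sub by (auto simp: topspace_weak_H1)
  show "openin ?X {x \<in> topspace ?X. r < dyn_cost k a x}"
  proof (subst openin_subopen, intro ballI)
    fix w0 assume "w0 \<in> {x \<in> topspace ?X. r < dyn_cost k a x}"
    with sub have w0: "w0 \<in> H1_halfspace k" "w0 \<in> H1" and r: "r < action k a w0"
      by (auto simp: top dyn_cost_def)
    let ?v0 = "velocity w0"
    note v0 = has_velocity_velocity[OF w0(2)]
    note sq0 = has_velocity_square_integrable[OF v0]
    obtain \<delta> S where \<delta>: "0 < \<delta>" and S: "S \<in> sets borel" "S \<subseteq> {0..1}" "\<And>t. t \<in> S \<Longrightarrow> \<delta> \<le> w0 t $ k"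
      and rS: "r < ennreal (LINT t:{0..1}|lborel. weight ?b S t * (norm (?v0 t))\<^sup>2)"
      using less_action_imp_less_weighted[OF w0(1) r] by blast
    define Q where "Q v = (LINT t:{0..1}|lborel. weight ?b S t * (norm (v t))\<^sup>2)" for v :: "real \<Rightarrow> real ^ 'a"
    obtain \<rho> where \<rho>: "r = ennreal \<rho>" "0 \<le> \<rho>" "\<rho> < Q ?v0"
    proof (cases r)
      case (real \<rho>)
      with rS show ?thesis by (intro that[of \<rho>]) (auto simp: Q_def ennreal_less_iff)
    qed (use rS in simp)
    define l where "l w = (LINT t:{0..1}|lborel. ((2 * weight ?b S t) *\<^sub>R ?v0 t) \<bullet> velocity w t)"
      for w :: "real \<Rightarrow> real ^ 'a"
    have l: "l \<in> H1_dual"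
      unfolding l_def[abs_def]
      by (intro H1_dual_velocity square_integrable_weight[OF sq0, of _ 2])
        (use S weight_abs_le[of ?b] in \<open>auto simp: abs_mult\<close>)
    \<comment> \<open>Energy bound shared by \<open>w0\<close> and every competitor of action at
      most \<open>\<rho>\<close>, since the action is at least
      \<open>energy / (2 * ?b)\<close>.\<close>
    define E where "E = max (energy w0) (2 * ?b * \<rho>)"
    \<comment> \<open>With mesh \<open>1 / N\<close>, curves of energy at most \<open>E\<close> vary
      by at most \<open>sqrt (E / N) < \<delta> / 3\<close> between a time and a neighbouring grid
      point.\<close>
    obtain N :: nat where N: "9 * E / \<delta>\<^sup>2 < real N" using reals_Archimedean2 by blast
    have "0 \<le> E" using energy_nonneg[of w0] by (auto simp: E_def)
    with N have N0: "0 < N" by (cases N) (auto simp: divide_less_0_iff)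
    with N \<delta> have EN: "E / real N < (\<delta> / 3)\<^sup>2" by (simp add: field_simps power2_eq_square)
    define p where "p i = real i / real N" for i
    have p: "p i \<in> {0..1}" if "i \<le> N" for i using that N0 by (auto simp: p_def)
    \<comment> \<open>The first condition loses less than the gap \<open>Q ?v0 - \<rho>\<close> in
      the tangent inequality. The grid conditions are one-sided, as a competitor only has to be kept
      from dropping to the boundary.\<close>
    define T where "T = {w \<in> H1. l w \<in> {l w0 - (Q ?v0 - \<rho>)<..}} \<inter>
      (\<Inter>i\<in>{..N}. {w \<in> H1. w (p i) $ k \<in> {w0 (p i) $ k - \<delta> / 3<..}})"
    have "openin weak_H1 T"
      unfolding T_def
      by (intro openin_Int openin_INT2 openin_weak_H1 l H1_dual_eval p) auto
    then have open_T: "openin ?X (T \<inter> H1_halfspace k)" by (auto simp: openin_subtopology)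
    have w0_T: "w0 \<in> T \<inter> H1_halfspace k"
      using w0 \<rho> \<delta> by (auto simp: T_def)
    have "r < dyn_cost k a w" if w: "w \<in> T \<inter> H1_halfspace k" for w
    proof (rule ccontr)
      assume "\<not> r < dyn_cost k a w"
      moreover have H: "w \<in> H1" using w sub by auto
      ultimately have le: "action k a w \<le> ennreal \<rho>" by (simp add: dyn_cost_def \<rho> not_less)
      note v = has_velocity_velocity[OF H]
      have "ennreal (1 / (2 * ?b) * energy w) \<le> ennreal \<rho>" using energy_le_action[OF H] le by (rule order_trans)
      then have "1 / (2 * ?b) * energy w \<le> \<rho>" using \<rho>(2) by (simp add: ennreal_le_iff)
      then have "energy w \<le> 2 * ?b * \<rho>" by (simp add: field_simps)
      then have Ew: "energy w \<le> E" "energy w0 \<le> E" by (auto simp: E_def)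
      have osc: "\<bar>u t $ k - u (p i) $ k\<bar> < \<delta> / 3"
        if u: "u \<in> H1" "energy u \<le> E" and t: "t \<in> {0..1}" "i \<le> N" "\<bar>t - p i\<bar> \<le> 1 / real N" for u t i
      proof -
        have "(norm (u t - u (p i)))\<^sup>2 \<le> \<bar>t - p i\<bar> * energy u"
          by (rule H1_Hoelder[OF u(1) p[OF t(2)] t(1)])
        also have "\<dots> \<le> 1 / real N * E" using t u \<open>0 \<le> E\<close> energy_nonneg[of u] by (intro mult_mono) auto
        also have "\<dots> < (\<delta> / 3)\<^sup>2" using EN by simp
        finally have "norm (u t - u (p i)) < \<delta> / 3"
          by (rule power2_less_imp_less) (use \<delta> in simp)
        then show ?thesis using component_le_norm_cart[of "u t - u (p i)" k] by simp
      qed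
      \<comment> \<open>The oscillation of \<open>w0\<close>, the loss at the grid point and the
        oscillation of \<open>w\<close> are each below \<open>\<delta> / 3\<close> and cannot use up
        the margin \<open>\<delta>\<close>.\<close>
      have pos: "w t $ k \<noteq> 0" if t: "t \<in> S" for t
      proof -
        \<comment> \<open>Grid point to the left of \<open>t\<close>. The time \<open>t = 1\<close>
          yields \<open>i = N\<close>, so the index range has to include \<open>N\<close>.\<close>
        define i where "i = nat \<lfloor>t * real N\<rfloor>"
        have t01: "t \<in> {0..1}" using t S by auto
        then have nn: "0 \<le> t * real N" and "t * real N \<le> real N"
          by (auto simp: mult_left_le_one_le)
        then have "\<lfloor>t * real N\<rfloor> \<le> int N" by (simp add: floor_le_iff)
        with nn have iN: "i \<le> N" by (simp add: i_def nat_le_iff)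
        have "real i = of_int \<lfloor>t * real N\<rfloor>" using nn by (simp add: i_def)
        then have "\<bar>t * real N - real i\<bar> \<le> 1" by linarith
        moreover have "t - p i = (t * real N - real i) / real N" using N0 by (simp add: p_def field_simps)
        ultimately have "\<bar>t - p i\<bar> \<le> 1 / real N" using N0 by (simp add: divide_right_mono)
        from osc[OF w0(2) Ew(2) t01 iN this] osc[OF H Ew(1) t01 iN this]
        have "\<bar>w0 t $ k - w0 (p i) $ k\<bar> < \<delta> / 3" "\<bar>w t $ k - w (p i) $ k\<bar> < \<delta> / 3" .
        moreover have "w0 (p i) $ k - \<delta> / 3 < w (p i) $ k" using w iN by (auto simp: T_def)
        ultimately show ?thesis using S(3)[OF t] by linarith
      qed
      have "ennreal (Q (velocity w)) \<le> ennreal \<rho>"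
        unfolding Q_def by (rule order_trans[OF weighted_le_action[OF v S(1) pos] le])
      then have "Q (velocity w) \<le> \<rho>" using \<rho>(2) by (simp add: ennreal_le_iff)
      moreover have "Q ?v0 + l w - l w0 \<le> Q (velocity w)"
        unfolding Q_def l_def
        by (rule weighted_convex[OF sq0 has_velocity_square_integrable[OF v] S(1)]) simp
      moreover have "l w0 - (Q ?v0 - \<rho>) < l w" using w by (auto simp: T_def)
      ultimately show False by linarith
    qed
    with open_T w0_T top show "\<exists>T. openin ?X T \<and> w0 \<in> T \<and> T \<subseteq> {x \<in> topspace ?X. r < dyn_cost k a x}"
      by (intro exI[of _ "T \<inter> H1_halfspace k"]) auto
  qed
qed

section \<open>Straight and broken paths\<close>

lemma set_integral_inner_velocity:
  assumes "has_velocity w v" "0 \<le> s" "s \<le> t" "t \<le> 1"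
  shows "(LINT r:{s..t}|lborel. c \<bullet> v r) = c \<bullet> (w t - w s)"
proof -
  have "set_integrable lborel {s..t} v"
    using assms(2,4) by (intro set_integrable_subinterval[OF square_integrable_imp_integrable
          [OF has_velocity_square_integrable[OF assms(1)]]])
  then show ?thesis
    using integral_inner_right[of c lborel "\<lambda>r. indicator {s..t} r *\<^sub>R v r"]
    by (simp add: has_velocity_diff[OF assms] set_lebesgue_integral_def set_integrable_def)
qed

text \<open>Turns a vanishing quadratic remainder into equality of curves: the velocities agree
  almost everywhere, and the starting points agree.\<close>

lemma curve_eqI_velocity:
  assumes w: "has_velocity w v" and g: "has_velocity g u" and "w 0 = g 0"
    and le: "(LINT t:{0..1}|lborel. (norm (v t - u t))\<^sup>2) \<le> 0" and t: "t \<in> {0..1}"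
  shows "w t = g t"
proof -
  let ?f = "\<lambda>t. indicat_real {0..1} t *\<^sub>R (norm (v t - u t))\<^sup>2"
  have i: "integrable lborel ?f"
    using square_integrable_norm_sq[OF square_integrable_diff
        [OF has_velocity_square_integrable[OF w] has_velocity_square_integrable[OF g]]]
    by (simp add: set_integrable_def)
  have "(LINT t:{0..1}|lborel. (norm (v t - u t))\<^sup>2) = 0"
    by (rule antisym[OF le]) (rule set_integral_nonneg, simp)
  then have "(LINT t|lborel. ?f t) = 0"
    by (simp only: set_lebesgue_integral_def)
  then have AE: "AE t in lborel. ?f t = 0"
    using i by (subst (asm) integral_nonneg_eq_0_iff_AE) auto
  have "(LINT s:{0..t}|lborel. v s) = (LINT s:{0..t}|lborel. u s)"
  proof (rule set_integral_AE_cong)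
    show "set_integrable lborel {0..t} v" "set_integrable lborel {0..t} u"
      using t by (auto intro!: set_integrable_subinterval[of _ 0 t]
          square_integrable_imp_integrable[OF has_velocity_square_integrable[OF w]]
          square_integrable_imp_integrable[OF has_velocity_square_integrable[OF g]])
    show "AE s in lborel. s \<in> {0..t} \<longrightarrow> v s = u s"
      using AE by eventually_elim (use t in \<open>auto split: split_indicator_asm\<close>)
  qed
  with has_velocity_eq[OF w t] has_velocity_eq[OF g t] \<open>w 0 = g 0\<close> show ?thesis by simp
qed

lemma has_velocityI_deriv:
  assumes cont: "continuous_on {0..1} g" and F: "finite F"
    and d: "\<And>t. t \<in> {0<..<1} - F \<Longrightarrow> (g has_vector_derivative v t) (at t)"
    and v: "v \<in> borel_measurable borel" "\<And>t. norm (v t) \<le> B"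
  shows "has_velocity g v"
proof (rule has_velocityI)
  show sq: "square_integrable v" by (rule square_integrable_bounded[OF v])
  fix t :: real assume t: "t \<in> {0..1}"
  have "(v has_integral g t - g 0) {0..t}"
    by (rule fundamental_theorem_of_calculus_interior_strong[OF F])
      (use t d in \<open>auto intro: continuous_on_subset[OF cont]\<close>)
  moreover have "(LINT s:{0..t}|lborel. v s) = integral {0..t} v"
    by (rule set_borel_integral_eq_integral(2), rule set_integrable_subinterval[OF square_integrable_imp_integrable[OF sq]])
      (use t in auto)
  ultimately show "g t = g 0 + (LINT s:{0..t}|lborel. v s)" by (simp add: integral_unique)
qed

lemma has_velocity_line:
  "has_velocity (\<lambda>t. (1 - t) *\<^sub>R x + t *\<^sub>R y) (\<lambda>t. y - x)"
  by (rule has_velocityI_deriv[where F = "{}" and B = "norm (y - x)"])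
    (auto intro!: continuous_intros derivative_eq_intros simp: has_vector_derivative_def fun_eq_iff algebra_simps)

lemma action_le_const:
  assumes v: "has_velocity g v" and le: "\<And>t. t \<in> {0..1} \<Longrightarrow> lagrangian k a (g t) (v t) \<le> c"
  shows "action k a g \<le> ennreal c"
proof -
  have "action k a g = (\<integral>\<^sup>+t\<in>{0..1}. ennreal (lagrangian k a (g t) (v t)) \<partial>lborel)"
    by (rule action_eq[OF v])
  also have "\<dots> \<le> (\<integral>\<^sup>+t. ennreal c * indicator {0..1::real} t \<partial>lborel)"
    by (rule nn_integral_mono) (auto intro!: ennreal_leI le split: split_indicator)
  also have "\<dots> = ennreal c" by (simp add: nn_integral_cmult)
  finally show ?thesis .
qed

lemma lagrangian_le: "lagrangian k a x q \<le> 1 / 2 * (norm q)\<^sup>2"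
  unfolding lagrangian_eq by (intro mult_right_mono) (auto simp: field_simps max_def)

text \<open>Only an inequality: for \<open>a > 1\<close> a line between two boundary points runs
  along the boundary at reduced cost.\<close>

lemma action_line_le: "action k a (\<lambda>t. (1 - t) *\<^sub>R x + t *\<^sub>R y) \<le> ennreal (1 / 2 * (norm (x - y))\<^sup>2)"
  by (rule action_le_const[OF has_velocity_line]) (use lagrangian_le norm_minus_commute in metis)

lemma line_in_conn:
  assumes "x \<in> halfspace k" "y \<in> halfspace k"
  shows "(\<lambda>t. (1 - t) *\<^sub>R x + t *\<^sub>R y) \<in> conn k x y"
  using assms has_velocity_imp_H1[OF has_velocity_line[of x y]]
  by (auto simp: conn_def H1_halfspace_def halfspace_def intro!: add_nonneg_nonneg mult_nonneg_nonneg)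

text \<open>The weight is \<open>1 / 2\<close> at all times, so the action dominates half the
  energy. This is the straight cost plus \<open>J / 2\<close>, with \<open>J\<close> the squared
  distance of the velocity from \<open>y - x\<close>.\<close>

lemma straight_action_bound:
  assumes w: "w \<in> conn k x y" and "a \<le> 1 \<or> (\<forall>t\<in>{0..1}. w t $ k \<noteq> 0)"
  shows "ennreal (1 / 2 * (norm (x - y))\<^sup>2) \<le> action k a w"
    and "action k a w \<le> ennreal (1 / 2 * (norm (x - y))\<^sup>2) \<Longrightarrow> t \<in> {0..1} \<Longrightarrow>
      w t = (1 - t) *\<^sub>R x + t *\<^sub>R y"
proof -
  let ?v = "velocity w"
  have xy: "w 0 = x" "w 1 = y" and H: "w \<in> H1" using w by (auto simp: conn_def H1_halfspace_def)
  note v = has_velocity_velocity[OF H]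
  define J where "J = (LINT t:{0..1}|lborel. (norm (?v t - (y - x)))\<^sup>2)"
  have J0: "0 \<le> J" unfolding J_def by (rule set_integral_nonneg) simp
  \<comment> \<open>For \<open>a \<le> 1\<close> both values of the weight are \<open>1 / 2\<close>,
    so the empty set works even for curves with contact.\<close>
  obtain S where S: "S \<in> sets borel" "\<And>t. t \<in> S \<Longrightarrow> t \<in> {0..1} \<Longrightarrow> w t $ k \<noteq> 0" "\<And>t. weight (max 1 a) S t = 1 / 2"
  proof (cases "a \<le> 1")
    case True
    then show ?thesis using that[of "{}"] by (auto simp: weight_def max_def)
  next
    case False
    then show ?thesis using that[of UNIV] assms(2) by (auto simp: weight_def)
  qed
  have "energy w = 2 * ((y - x) \<bullet> (y - x)) - (norm (y - x))\<^sup>2 + J"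
    using set_integral_norm_sq_expand[OF has_velocity_square_integrable[OF v], of 0 1 "y - x"]
      has_velocity_diff[OF v, of 0 1] by (simp add: xy energy_def J_def)
  then have e: "energy w = (norm (x - y))\<^sup>2 + J"
    by (simp add: norm_minus_commute flip: power2_norm_eq_inner)
  have "ennreal (1 / 2 * energy w) \<le> action k a w"
    using weighted_le_action[OF v S(1,2), where a = a] by (simp add: S(3) energy_def)
  then have bound: "ennreal (1 / 2 * (norm (x - y))\<^sup>2 + 1 / 2 * J) \<le> action k a w"
    by (simp add: e algebra_simps)
  then show "ennreal (1 / 2 * (norm (x - y))\<^sup>2) \<le> action k a w"
    by (rule order_trans[rotated]) (use J0 in \<open>auto intro: ennreal_leI\<close>)
  assume le: "action k a w \<le> ennreal (1 / 2 * (norm (x - y))\<^sup>2)" and t: "t \<in> {0..1}"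
  have "ennreal (1 / 2 * (norm (x - y))\<^sup>2 + 1 / 2 * J) \<le> ennreal (1 / 2 * (norm (x - y))\<^sup>2)"
    using bound le by (rule order_trans)
  then have "1 / 2 * (norm (x - y))\<^sup>2 + 1 / 2 * J \<le> 1 / 2 * (norm (x - y))\<^sup>2"
    by (subst (asm) ennreal_le_iff) auto
  then have "J \<le> 0" by simp
  then show "w t = (1 - t) *\<^sub>R x + t *\<^sub>R y"
    unfolding J_def by (intro curve_eqI_velocity[OF v has_velocity_line[of x y] _ _ t]) (auto simp: xy)
qed

definition broken_velocity :: "'a \<Rightarrow> 'a \<Rightarrow> 'a \<Rightarrow> real \<Rightarrow> real \<Rightarrow> real \<Rightarrow> 'a" where
  "broken_velocity A B C t1 t2 t = (if t < t1 then A else if t \<le> t2 then B else C)"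

text \<open>For \<open>0 \<le> t\<close> and \<open>t1 \<le> t2\<close> the coefficients are the
  times spent in the three phases up to \<open>t\<close>. This form makes continuity at the corners
  evident and allows empty phases.\<close>

definition broken_path :: "'a::real_vector \<Rightarrow> 'a \<Rightarrow> 'a \<Rightarrow> 'a \<Rightarrow> real \<Rightarrow> real \<Rightarrow> real \<Rightarrow> 'a" where
  "broken_path x A B C t1 t2 t = x + min t t1 *\<^sub>R A + (max t1 (min t t2) - t1) *\<^sub>R B + (max t t2 - t2) *\<^sub>R C"

lemma broken_velocity_measurable [measurable]:
  "broken_velocity A B C t1 t2 \<in> borel_measurable borel"
  unfolding broken_velocity_def[abs_def] by measurable

lemma norm_broken_velocity_le: "norm (broken_velocity A B C t1 t2 t) \<le> norm A + norm B + norm C"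
  by (auto simp: broken_velocity_def add_increasing add_increasing2)

lemma has_velocity_broken_path:
  fixes A B C :: "real ^ 'n::finite"
  assumes "0 \<le> t1" "t1 \<le> t2"
  shows "has_velocity (broken_path x A B C t1 t2) (broken_velocity A B C t1 t2)"
proof (rule has_velocityI_deriv[where F = "{t1, t2}"])
  show "continuous_on {0..1} (broken_path x A B C t1 t2)"
    unfolding broken_path_def[abs_def] by (intro continuous_intros)
  show "finite {t1, t2}" by simp
  show "broken_velocity A B C t1 t2 \<in> borel_measurable borel" by simp
  show "norm (broken_velocity A B C t1 t2 t) \<le> norm A + norm B + norm C" for t
    by (rule norm_broken_velocity_le)
  fix t assume t: "t \<in> {0<..<1} - {t1, t2}"
  consider "t < t1" | "t1 < t" "t < t2" | "t2 < t" using t assms by fastforce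
  then show "(broken_path x A B C t1 t2 has_vector_derivative broken_velocity A B C t1 t2 t) (at t)"
  proof cases
    case 1
    have "((\<lambda>t. x + t *\<^sub>R A) has_vector_derivative A) (at t)"
      by (auto intro!: derivative_eq_intros simp: has_vector_derivative_def)
    then have "(broken_path x A B C t1 t2 has_vector_derivative A) (at t)"
      by (rule has_vector_derivative_transform_within_open[where S = "{..<t1}"])
        (use 1 assms in \<open>auto simp: broken_path_def\<close>)
    then show ?thesis using 1 by (simp add: broken_velocity_def)
  next
    case 2
    have "((\<lambda>t. x + t1 *\<^sub>R A + (t - t1) *\<^sub>R B) has_vector_derivative B) (at t)"
      by (auto intro!: derivative_eq_intros simp: has_vector_derivative_def)
    then have "(broken_path x A B C t1 t2 has_vector_derivative B) (at t)"
      by (rule has_vector_derivative_transform_within_open[where S = "{t1<..<t2}"])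
        (use 2 assms in \<open>auto simp: broken_path_def\<close>)
    then show ?thesis using 2 by (simp add: broken_velocity_def)
  next
    case 3
    have "((\<lambda>t. x + t1 *\<^sub>R A + (t2 - t1) *\<^sub>R B + (t - t2) *\<^sub>R C) has_vector_derivative C) (at t)"
      by (auto intro!: derivative_eq_intros simp: has_vector_derivative_def)
    then have "(broken_path x A B C t1 t2 has_vector_derivative C) (at t)"
      by (rule has_vector_derivative_transform_within_open[where S = "{t2<..}"])
        (use 3 assms in \<open>auto simp: broken_path_def\<close>)
    then show ?thesis using 3 assms by (simp add: broken_velocity_def)
  qed
qed

section \<open>Curves touching the boundary\<close>

lemma integral_inner_broken_velocity:
  fixes A B C :: "real ^ 'n::finite"
  assumes v: "has_velocity w v" and t: "0 \<le> t1" "t1 \<le> t2" "t2 \<le> 1"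
  shows "(LINT t:{0..1}|lborel. broken_velocity A B C t1 t2 t \<bullet> v t) =
    A \<bullet> (w t1 - w 0) + B \<bullet> (w t2 - w t1) + C \<bullet> (w 1 - w t2)"
proof -
  let ?V = "broken_velocity A B C t1 t2"
  have cong: "(LINT r:{s..t}|lborel. ?V r \<bullet> v r) = c \<bullet> (w t - w s)"
    if st: "0 \<le> s" "s \<le> t" "t \<le> 1" and eq: "\<And>r. s < r \<Longrightarrow> r < t \<Longrightarrow> ?V r = c" for s t c
  proof -
    have "(LINT r:{s..t}|lborel. ?V r \<bullet> v r) = (LINT r:{s..t}|lborel. c \<bullet> v r)"
    proof (rule set_integral_AE_cong)
      have "square_integrable ?V" "square_integrable (\<lambda>t. c)"
        by (rule square_integrable_bounded[OF broken_velocity_measurable norm_broken_velocity_le]) simp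
      from this[THEN square_integrable_inner, OF has_velocity_square_integrable[OF v]]
      show "set_integrable lborel {s..t} (\<lambda>r. ?V r \<bullet> v r)" "set_integrable lborel {s..t} (\<lambda>r. c \<bullet> v r)"
        using st by (auto intro: set_integrable_subinterval[of _ s t])
      show "AE r in lborel. r \<in> {s..t} \<longrightarrow> ?V r \<bullet> v r = c \<bullet> v r"
        using AE_lborel_singleton[of s] AE_lborel_singleton[of t]
        by eventually_elim (use eq in force)
    qed
    then show ?thesis using set_integral_inner_velocity[OF v st] by simp
  qed
  have "square_integrable ?V"
    by (rule square_integrable_bounded[OF broken_velocity_measurable norm_broken_velocity_le])
  then have i: "set_integrable lborel {0..1} (\<lambda>t. ?V t \<bullet> v t)"
    by (rule square_integrable_inner[OF _ has_velocity_square_integrable[OF v]])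
  have "set_integrable lborel {0..t2} (\<lambda>t. ?V t \<bullet> v t)"
    by (rule set_integrable_subinterval[OF i]) (use t in auto)
  with i show ?thesis
    using t set_integral_combine[of 0 1 "\<lambda>t. ?V t \<bullet> v t" t2] set_integral_combine[of 0 t2 "\<lambda>t. ?V t \<bullet> v t" t1]
      cong[of 0 t1 A] cong[of t1 t2 B] cong[of t2 1 C]
    by (simp add: broken_velocity_def)
qed

text \<open>The contact set is compact and nonempty. Between \<open>t1\<close> and \<open>t2\<close>
  the curve may leave the boundary again; the action bound for touching curves grants it the cheap
  weight there.\<close>

lemma first_last_boundary_times:
  assumes w: "w \<in> H1" and s: "s \<in> {0..1}" "w s $ k = 0"
  obtains t1 t2 where "0 \<le> t1" "t1 \<le> t2" "t2 \<le> 1" "w t1 $ k = 0" "w t2 $ k = 0"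
    "\<And>t. t \<in> {0..1} \<Longrightarrow> t < t1 \<or> t2 < t \<Longrightarrow> w t $ k \<noteq> 0"
proof -
  define Z where "Z = {0..1} \<inter> (\<lambda>t. w t $ k) -` {0}"
  have "closed Z" unfolding Z_def
    by (rule continuous_closed_preimage) (intro continuous_intros H1_continuous_on[OF w], auto)
  moreover have "bounded Z" by (rule bounded_subset[of "{0..1}"]) (auto simp: Z_def)
  ultimately have "compact Z" by (simp add: compact_eq_bounded_closed)
  moreover have "Z \<noteq> {}" using s by (auto simp: Z_def)
  ultimately obtain t1 t2 where t1: "t1 \<in> Z" "\<And>t. t \<in> Z \<Longrightarrow> t1 \<le> t" and t2: "t2 \<in> Z" "\<And>t. t \<in> Z \<Longrightarrow> t \<le> t2"
    by (metis compact_attains_inf compact_attains_sup)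
  show ?thesis
  proof (rule that)
    show "0 \<le> t1" "t2 \<le> 1" "w t1 $ k = 0" "w t2 $ k = 0" using t1(1) t2(1) by (auto simp: Z_def)
    show "t1 \<le> t2" by (rule t1(2)[OF t2(1)])
    fix t :: real assume "t \<in> {0..1}" "t < t1 \<or> t2 < t"
    moreover from this have "t \<notin> Z" using t1(2)[of t] t2(2)[of t] by auto
    ultimately show "w t $ k \<noteq> 0" by (simp add: Z_def)
  qed
qed

text \<open>
  Calibration: outside the boundary the velocity is compared with the vectors \<open>p e - q n\<close> and
  \<open>p e + q n\<close> of norm at most 1, on the boundary with \<open>p a e\<close>, whose cost is at most that of a
  unit vector in the interior.  The total of the linear terms depends only on the end points.
\<close>

lemma touching_action_bound:
  fixes e x y :: "real ^ 'n::finite"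
  assumes a: "1 \<le> a" and e: "e $ k = 0" "norm e \<le> 1" and pq: "p\<^sup>2 * a \<le> 1" "p\<^sup>2 + q\<^sup>2 \<le> 1"
    and w: "w \<in> conn k x y" and s: "s \<in> {0..1}" "w s $ k = 0"
    and M: "M = p * (e \<bullet> (y - x)) + q * (x $ k + y $ k)"
  shows "ennreal (1 / 2 * M\<^sup>2) \<le> action k a w"
    and "action k a w \<le> ennreal (1 / 2 * M\<^sup>2) \<Longrightarrow>
      \<exists>t1 t2. 0 \<le> t1 \<and> t1 \<le> t2 \<and> t2 \<le> 1 \<and> w t1 $ k = 0 \<and> w t2 $ k = 0 \<and>
        (\<forall>t\<in>{0..1}. w t = broken_path x (M *\<^sub>R (p *\<^sub>R e - q *\<^sub>R axis k 1)) ((M * p * a) *\<^sub>R e)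
           (M *\<^sub>R (p *\<^sub>R e + q *\<^sub>R axis k 1)) t1 t2 t)"
proof -
  let ?v = "velocity w" and ?n = "axis k 1 :: real ^ 'n"
  let ?A = "M *\<^sub>R (p *\<^sub>R e - q *\<^sub>R ?n)" and ?B = "(M * p * a) *\<^sub>R e" and ?C = "M *\<^sub>R (p *\<^sub>R e + q *\<^sub>R ?n)"
  have xy: "w 0 = x" "w 1 = y" and H: "w \<in> H1" using w by (auto simp: conn_def H1_halfspace_def)
  note v = has_velocity_velocity[OF H]
  note sq = has_velocity_square_integrable[OF v]
  obtain t1 t2 where t: "0 \<le> t1" "t1 \<le> t2" "t2 \<le> 1" and z: "w t1 $ k = 0" "w t2 $ k = 0"
    and nz: "\<And>t. t \<in> {0..1} \<Longrightarrow> t < t1 \<or> t2 < t \<Longrightarrow> w t $ k \<noteq> 0"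
    using first_last_boundary_times[OF H s] by metis
  define S where "S = {..<t1} \<union> {t2<..}"
  have S: "S \<in> sets borel" by (simp add: S_def)
  \<comment> \<open>\<open>?V\<close> is the candidate velocity and \<open>?W\<close> the
    corresponding momentum: on the boundary the weight \<open>1 / (2 * a)\<close> divides the
    velocity \<open>(M * p * a) *\<^sub>R e\<close> by \<open>a\<close>, so the tangential momentum
    is \<open>(M * p) *\<^sub>R e\<close> in all three phases.\<close>
  let ?V = "broken_velocity ?A ?B ?C t1 t2" and ?W = "broken_velocity ?A ((M * p) *\<^sub>R e) ?C t1 t2"
  note V = has_velocity_broken_path[OF t(1,2), of x ?A ?B ?C]
  define J where "J = (LINT t:{0..1}|lborel. (norm (?v t - ?V t))\<^sup>2)"
  have J0: "0 \<le> J" unfolding J_def by (rule set_integral_nonneg) simp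
  have ne: "?n \<bullet> u = u $ k" "u \<bullet> ?n = u $ k" for u by (simp_all add: inner_axis inner_axis')
  have e2: "e \<bullet> e \<le> 1" using e(2) by (simp flip: power2_norm_eq_inner add: power_le_one)
  have pe: "p\<^sup>2 * (e \<bullet> e) \<le> p\<^sup>2" using mult_left_mono[OF e2, of "p\<^sup>2"] by simp
  have outer: "M\<^sup>2 * (p\<^sup>2 * (e \<bullet> e) + q\<^sup>2) \<le> M\<^sup>2"
    using mult_left_mono[of "p\<^sup>2 * (e \<bullet> e) + q\<^sup>2" 1 "M\<^sup>2"] pe pq(2) by simp
  have nA: "(norm ?A)\<^sup>2 \<le> M\<^sup>2" and nC: "(norm ?C)\<^sup>2 \<le> M\<^sup>2"
  proof -
    have "(norm (p *\<^sub>R e - q *\<^sub>R ?n))\<^sup>2 = p\<^sup>2 * (e \<bullet> e) + q\<^sup>2" "(norm (p *\<^sub>R e + q *\<^sub>R ?n))\<^sup>2 = p\<^sup>2 * (e \<bullet> e) + q\<^sup>2"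
      unfolding power2_norm_eq_inner by (simp_all add: inner_simps ne e power2_eq_square)
    then show "(norm ?A)\<^sup>2 \<le> M\<^sup>2" "(norm ?C)\<^sup>2 \<le> M\<^sup>2"
      using outer by (simp_all add: power_mult_distrib)
  qed
  have inner: "(norm ?B)\<^sup>2 \<le> a * M\<^sup>2"
  proof -
    have "(p\<^sup>2 * a) * (e \<bullet> e) \<le> 1 * 1" using pq(1) e2 a by (intro mult_mono) auto
    then have "(a * M\<^sup>2) * ((p\<^sup>2 * a) * (e \<bullet> e)) \<le> (a * M\<^sup>2) * 1" using a by (intro mult_left_mono) auto
    moreover have "(norm ?B)\<^sup>2 = (a * M\<^sup>2) * ((p\<^sup>2 * a) * (e \<bullet> e))"
      unfolding power2_norm_eq_inner by (simp add: power2_eq_square)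
    ultimately show ?thesis by simp
  qed
  \<comment> \<open>Completing the square around \<open>?V\<close>. The quadratic term has the
    factor \<open>1 / 2\<close> on \<open>S\<close> and \<open>1 / (2 * a)\<close> elsewhere; the
    smaller factor is kept throughout.\<close>
  have pointwise: "?W t \<bullet> ?v t - 1 / 2 * M\<^sup>2 + 1 / (2 * a) * (norm (?v t - ?V t))\<^sup>2
      \<le> weight a S t * (norm (?v t))\<^sup>2" for t
  proof -
    have expand: "c * (norm u)\<^sup>2 = 2 * c * (U \<bullet> u) - c * (norm U)\<^sup>2 + c * (norm (u - U))\<^sup>2"
      for c and u U :: "real ^ 'n"
      by (simp add: power2_norm_eq_inner inner_simps inner_commute algebra_simps)
    show ?thesis
    proof (cases "t \<in> S")
      case True
      then have "?W t = ?V t" "(norm (?V t))\<^sup>2 \<le> M\<^sup>2"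
        using nA nC t by (auto simp: S_def broken_velocity_def)
      moreover have "1 / (2 * a) * (norm (?v t - ?V t))\<^sup>2 \<le> 1 / 2 * (norm (?v t - ?V t))\<^sup>2"
        using a by (intro mult_right_mono) (auto simp: field_simps)
      ultimately show ?thesis using True expand[of "1/2" "?v t" "?V t"] by (simp add: weight_def)
    next
      case False
      then have eq: "?W t = (M * p) *\<^sub>R e" "?V t = ?B" by (auto simp: S_def broken_velocity_def)
      have "1 / (2 * a) * (norm ?B)\<^sup>2 \<le> 1 / (2 * a) * (a * M\<^sup>2)"
        using inner a by (intro mult_left_mono) auto
      then have "1 / (2 * a) * (norm ?B)\<^sup>2 \<le> 1 / 2 * M\<^sup>2" using a by simp
      moreover have "2 * (1 / (2 * a)) * (?B \<bullet> ?v t) = ((M * p) *\<^sub>R e) \<bullet> ?v t" using a by simp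
      moreover have "weight a S t = 1 / (2 * a)" using False by (simp add: weight_def)
      ultimately show ?thesis
        unfolding eq using expand[of "1 / (2 * a)" "?v t" ?B] by (simp only:)
    qed
  qed
  have sqW: "square_integrable ?W"
    by (rule square_integrable_bounded[OF broken_velocity_measurable norm_broken_velocity_le])
  note i = square_integrable_inner[OF sqW sq]
    square_integrable_norm_sq[OF square_integrable_diff[OF sq has_velocity_square_integrable[OF V]]]
  \<comment> \<open>The tangential momentum is the same in all phases and telescopes; the normal one
    contributes \<open>x $ k\<close> and \<open>y $ k\<close>, because the normal coordinate of
    \<open>w\<close> vanishes at \<open>t1\<close> and \<open>t2\<close>. The factor
    \<open>M\<close> in the velocities makes the total \<open>M^2\<close>, of which the constant
    term takes away half.\<close>
  have "(LINT t:{0..1}|lborel. ?W t \<bullet> ?v t) = M\<^sup>2"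
  proof -
    have "(LINT t:{0..1}|lborel. ?W t \<bullet> ?v t) = M * (p * (e \<bullet> (y - x)) + q * (x $ k + y $ k))"
      by (simp add: integral_inner_broken_velocity[OF v t] xy inner_simps ne z algebra_simps)
    then show ?thesis by (simp flip: M add: power2_eq_square)
  qed
  moreover have "(LINT t:{0..1}|lborel. ?W t \<bullet> ?v t - 1 / 2 * M\<^sup>2 + 1 / (2 * a) * (norm (?v t - ?V t))\<^sup>2) =
      (LINT t:{0..1}|lborel. ?W t \<bullet> ?v t) - 1 / 2 * M\<^sup>2 + 1 / (2 * a) * J"
    using i by (simp add: set_integral_add set_integral_diff set_integral_const_interval J_def del: times_divide_eq_left)
  moreover have "(LINT t:{0..1}|lborel. ?W t \<bullet> ?v t - 1 / 2 * M\<^sup>2 + 1 / (2 * a) * (norm (?v t - ?V t))\<^sup>2)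
      \<le> (LINT t:{0..1}|lborel. weight a S t * (norm (?v t))\<^sup>2)"
    by (rule set_integral_mono)
      (use i weighted_norm_sq_integrable[OF sq S a] pointwise in \<open>auto intro!: set_integral_add set_integral_diff\<close>)
  ultimately have "1 / 2 * M\<^sup>2 + 1 / (2 * a) * J \<le> (LINT t:{0..1}|lborel. weight a S t * (norm (?v t))\<^sup>2)"
    by simp
  then have "ennreal (1 / 2 * M\<^sup>2 + 1 / (2 * a) * J) \<le> ennreal (LINT t:{0..1}|lborel. weight a S t * (norm (?v t))\<^sup>2)"
    by (rule ennreal_leI)
  also have "\<dots> \<le> action k a w"
    using weighted_le_action[OF v S, of k a] nz a by (simp add: S_def max_def split: if_splits)
  finally have bound: "ennreal (1 / 2 * M\<^sup>2 + 1 / (2 * a) * J) \<le> action k a w" .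
  then show "ennreal (1 / 2 * M\<^sup>2) \<le> action k a w"
    by (rule order_trans[rotated]) (use J0 a in \<open>auto intro: ennreal_leI\<close>)
  assume "action k a w \<le> ennreal (1 / 2 * M\<^sup>2)"
  with bound have "ennreal (1 / 2 * M\<^sup>2 + 1 / (2 * a) * J) \<le> ennreal (1 / 2 * M\<^sup>2)" by (rule order_trans)
  then have "1 / (2 * a) * J \<le> 0" by (subst (asm) ennreal_le_iff) auto
  then have "J \<le> 0" using a by (simp add: divide_le_0_iff)
  then have "w t = broken_path x ?A ?B ?C t1 t2 t" if "t \<in> {0..1}" for t
    unfolding J_def using t
    by (intro curve_eqI_velocity[OF v V _ _ that]) (auto simp: xy broken_path_def)
  with t z show "\<exists>t1 t2. 0 \<le> t1 \<and> t1 \<le> t2 \<and> t2 \<le> 1 \<and> w t1 $ k = 0 \<and> w t2 $ k = 0 \<and>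
        (\<forall>t\<in>{0..1}. w t = broken_path x ?A ?B ?C t1 t2 t)"
    by blast
qed

lemma tang_nth: "tang k x $ i = (if i = k then 0 else x $ i)"
  by (simp add: tang_def)

lemma tang_eq: "tang k x = x - (x $ k) *\<^sub>R axis k 1"
  by (simp add: vec_eq_iff tang_nth axis_def)

text \<open>
  The broken_path line through \<open>z_in\<close> and \<open>z_out\<close>, run with constant cost \<open>M\<^sup>2 / 2\<close>.
\<close>

definition touching_path :: "'n::finite \<Rightarrow> real \<Rightarrow> real ^ 'n \<Rightarrow> real ^ 'n \<Rightarrow> real \<Rightarrow> real ^ 'n" where
  "touching_path k a x y = (let
     e = sgn (tang k y - tang k x); p = 1 / sqrt a; q = sqrt (a - 1) / sqrt a;
     M = (norm (tang k y - tang k x) + sqrt (a - 1) * (x $ k + y $ k)) / sqrt a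
   in broken_path x (M *\<^sub>R (p *\<^sub>R e - q *\<^sub>R axis k 1)) ((M * p * a) *\<^sub>R e) (M *\<^sub>R (p *\<^sub>R e + q *\<^sub>R axis k 1))
        (x $ k / (M * q)) (1 - y $ k / (M * q)))"

lemma straight_on_broken_path:
  fixes A B C :: "real ^ 'n::finite"
  assumes "0 \<le> t1" "t1 \<le> t2" "t2 \<le> 1"
  shows "straight_on (broken_path x A B C t1 t2) 0 t1 x (x + t1 *\<^sub>R A)"
    and "straight_on (broken_path x A B C t1 t2) t1 t2 (x + t1 *\<^sub>R A) (x + t1 *\<^sub>R A + (t2 - t1) *\<^sub>R B)"
    and "straight_on (broken_path x A B C t1 t2) t2 1 (x + t1 *\<^sub>R A + (t2 - t1) *\<^sub>R B)
      (x + t1 *\<^sub>R A + (t2 - t1) *\<^sub>R B + (1 - t2) *\<^sub>R C)"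
proof -
  have *: "s \<le> linepath s u \<theta> \<and> linepath s u \<theta> \<le> u" if "s \<le> u" "\<theta> \<in> {0..1}" for s u \<theta> :: real
  proof -
    have "linepath s u \<theta> = s + \<theta> * (u - s)" by (simp add: linepath_def algebra_simps)
    moreover have "0 \<le> \<theta> * (u - s)" "\<theta> * (u - s) \<le> 1 * (u - s)"
      using that by (simp, intro mult_right_mono) auto
    ultimately show ?thesis by simp
  qed
  have 1: "broken_path x A B C t1 t2 t = x + t *\<^sub>R A" if "t \<le> t1" for t
    using that assms by (simp add: broken_path_def)
  have 2: "broken_path x A B C t1 t2 t = x + t1 *\<^sub>R A + (t - t1) *\<^sub>R B" if "t1 \<le> t" "t \<le> t2" for t
    using that assms by (simp add: broken_path_def)
  have 3: "broken_path x A B C t1 t2 t = x + t1 *\<^sub>R A + (t2 - t1) *\<^sub>R B + (t - t2) *\<^sub>R C" if "t2 \<le> t" for t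
    using that assms by (simp add: broken_path_def)
  show "straight_on (broken_path x A B C t1 t2) 0 t1 x (x + t1 *\<^sub>R A)"
    unfolding straight_on_def using *[of 0 t1] assms 1 by (auto simp: linepath_def algebra_simps)
  show "straight_on (broken_path x A B C t1 t2) t1 t2 (x + t1 *\<^sub>R A) (x + t1 *\<^sub>R A + (t2 - t1) *\<^sub>R B)"
    unfolding straight_on_def
  proof
    fix \<theta> :: real assume "\<theta> \<in> {0..1}"
    then have "t1 \<le> linepath t1 t2 \<theta>" "linepath t1 t2 \<theta> \<le> t2" using *[of t1 t2 \<theta>] assms by auto
    from 2[OF this] show "broken_path x A B C t1 t2 (linepath t1 t2 \<theta>) =
        linepath (x + t1 *\<^sub>R A) (x + t1 *\<^sub>R A + (t2 - t1) *\<^sub>R B) \<theta>"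
      by (simp only:) (simp add: linepath_def algebra_simps)
  qed
  show "straight_on (broken_path x A B C t1 t2) t2 1 (x + t1 *\<^sub>R A + (t2 - t1) *\<^sub>R B)
      (x + t1 *\<^sub>R A + (t2 - t1) *\<^sub>R B + (1 - t2) *\<^sub>R C)"
    unfolding straight_on_def
  proof
    fix \<theta> :: real assume "\<theta> \<in> {0..1}"
    then have "t2 \<le> linepath t2 1 \<theta>" using *[of t2 1 \<theta>] assms by auto
    from 3[OF this] show "broken_path x A B C t1 t2 (linepath t2 1 \<theta>) =
        linepath (x + t1 *\<^sub>R A + (t2 - t1) *\<^sub>R B) (x + t1 *\<^sub>R A + (t2 - t1) *\<^sub>R B + (1 - t2) *\<^sub>R C) \<theta>"
      by (simp only:) (simp add: linepath_def algebra_simps)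
  qed
qed

text \<open>A geodesic is determined on \<open>{0..1}\<close> only, whereas
  \<open>touching_path\<close> is a function on all reals.\<close>

lemma three_segments_cong:
  assumes "three_segments k \<alpha> x y g" "\<And>t. t \<in> {0..1} \<Longrightarrow> h t = g t"
  shows "three_segments k \<alpha> x y h"
proof -
  have *: "linepath s u \<theta> \<in> {0..1}" if "0 \<le> s" "s \<le> u" "u \<le> 1" "\<theta> \<in> {0..1}" for s u \<theta> :: real
    using that by (auto simp: linepath_def intro!: add_nonneg_nonneg mult_nonneg_nonneg convex_bound_le)
  have "straight_on h s u v w" if "0 \<le> s" "s \<le> u" "u \<le> 1" "straight_on g s u v w" for s u v w
    using that assms(2) * unfolding straight_on_def by metis
  moreover obtain t1 t2 where "0 \<le> t1" "t1 \<le> t2" "t2 \<le> 1"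
    "straight_on g 0 t1 x (z_in k \<alpha> x y)" "straight_on g t1 t2 (z_in k \<alpha> x y) (z_out k \<alpha> x y)"
    "straight_on g t2 1 (z_out k \<alpha> x y) y"
    using assms(1) unfolding three_segments_def by blast
  ultimately show ?thesis
    unfolding three_segments_def by (intro exI[of _ t1] exI[of _ t2]) auto
qed

section \<open>The tangential direction of the chord, and flat chords\<close>

context
  fixes k :: "'n::finite" and x y e :: "real ^ 'n" and r :: real
  defines "e \<equiv> sgn (tang k y - tang k x)" and "r \<equiv> norm (tang k y - tang k x)"
begin

lemma sgn_tang_nth: "e $ k = 0"
  by (simp add: e_def sgn_div_norm tang_nth)

text \<open>Not an equality: \<open>sgn 0 = 0\<close> if the chord has no tangential part, which is
  always so in dimension one.\<close>

lemma norm_sgn_tang_le: "norm e \<le> 1"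
  by (simp add: e_def norm_sgn)

private lemma r_nonneg: "0 \<le> r"
  by (simp add: r_def)

lemma scaleR_sgn_tang: "r *\<^sub>R e = y - x - (y $ k - x $ k) *\<^sub>R axis k 1"
proof -
  have "r *\<^sub>R e = tang k y - tang k x"
    by (cases "tang k y - tang k x = 0") (simp_all add: e_def r_def sgn_div_norm)
  then show ?thesis by (simp add: tang_eq algebra_simps)
qed

lemma inner_sgn_tang: "e \<bullet> (y - x) = r"
proof -
  have "y - x = r *\<^sub>R e + (y $ k - x $ k) *\<^sub>R axis k 1" by (simp add: scaleR_sgn_tang)
  then have "e \<bullet> (y - x) = r * (e \<bullet> e)"
    by (simp add: inner_simps inner_axis sgn_tang_nth)
  then show ?thesis by (auto simp: e_def r_def norm_sgn simp flip: power2_norm_eq_inner)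
qed

lemma norm_diff_sq_tang: "(norm (x - y))\<^sup>2 = r\<^sup>2 + (x $ k - y $ k)\<^sup>2"
proof -
  have "(norm (x - y))\<^sup>2 = (y - x) \<bullet> (y - x)" by (metis norm_minus_commute power2_norm_eq_inner)
  also have "\<dots> = (r *\<^sub>R e + (y $ k - x $ k) *\<^sub>R axis k 1) \<bullet> (y - x)"
    by (simp add: scaleR_sgn_tang)
  also have "\<dots> = r * r + (y $ k - x $ k) * (y $ k - x $ k)"
    by (simp only: inner_add_left inner_scaleR_left inner_sgn_tang) (simp add: inner_axis')
  finally show ?thesis by (simp add: power2_eq_square algebra_simps)
qed

text \<open>
  When the chord is flat, the comparison is with the straight path to the mirror image of \<open>y\<close>.
\<close>

lemma flat_touching_action_bound:
  assumes a: "1 < a" and xy: "x \<in> halfspace k" "y \<in> halfspace k"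
    and flat: "sqrt (a - 1) * r \<le> x $ k + y $ k"
    and w: "w \<in> conn k x y" and s: "s \<in> {0..1}" "w s $ k = 0"
  shows "ennreal (1 / 2 * (norm (x - y))\<^sup>2) \<le> action k a w"
    and "action k a w \<le> ennreal (1 / 2 * (norm (x - y))\<^sup>2) \<Longrightarrow> t \<in> {0..1} \<Longrightarrow>
      w t = (1 - t) *\<^sub>R x + t *\<^sub>R y"
proof -
  define \<sigma> where "\<sigma> = x $ k + y $ k"
  \<comment> \<open>The distance from \<open>x\<close> to the mirror image of \<open>y\<close>;
    \<open>(p, q)\<close> is the unit vector with tangential and normal parts proportional to
    \<open>r\<close> and \<open>\<sigma>\<close>, and \<open>(0, 0)\<close> if \<open>m = 0\<close>,
    by the convention on division.\<close>
  define m where "m = sqrt (r\<^sup>2 + \<sigma>\<^sup>2)"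
  define p where "p = r / m"
  define q where "q = \<sigma> / m"
  have nn: "0 \<le> x $ k" "0 \<le> y $ k" "0 \<le> \<sigma>" using xy by (auto simp: halfspace_def \<sigma>_def)
  have m2: "m\<^sup>2 = r\<^sup>2 + \<sigma>\<^sup>2" by (simp add: m_def)
  have m_0: "m = 0 \<longleftrightarrow> r = 0 \<and> \<sigma> = 0" by (simp add: m_def)
  have mp: "m * p = r" and mq: "m * q = \<sigma>" using m_0 by (auto simp: p_def q_def)
  have M: "m = p * (e \<bullet> (y - x)) + q * (x $ k + y $ k)"
  proof (cases "m = 0")
    case False
    then have "m * m = r * r + \<sigma> * \<sigma>" using m2 by (simp add: power2_eq_square)
    with False show ?thesis unfolding inner_sgn_tang \<sigma>_def[symmetric] by (simp add: p_def q_def field_simps)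
  qed (simp add: p_def q_def)
  have pq: "p\<^sup>2 + q\<^sup>2 \<le> 1"
    using m2 by (cases "m = 0") (auto simp: p_def q_def power_divide simp flip: add_divide_distrib)
  \<comment> \<open>Flatness is the constraint \<open>p^2 * a \<le> 1\<close> in disguise: squared,
    it reads \<open>(a - 1) * r^2 \<le> \<sigma>^2\<close>.\<close>
  have "(sqrt (a - 1) * r)\<^sup>2 \<le> \<sigma>\<^sup>2" using flat a r_nonneg by (intro power_mono) (auto simp: \<sigma>_def)
  then have "a * r\<^sup>2 \<le> m\<^sup>2" using a by (simp add: m2 power_mult_distrib algebra_simps)
  then have pa: "p\<^sup>2 * a \<le> 1"
    by (cases "m = 0") (auto simp: p_def power_divide field_simps)
  have sq: "\<sigma>\<^sup>2 = (x $ k - y $ k)\<^sup>2 + 4 * (x $ k * y $ k)"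
    by (simp add: \<sigma>_def power2_eq_square algebra_simps)
  have le: "1 / 2 * (norm (x - y))\<^sup>2 \<le> 1 / 2 * m\<^sup>2"
    using nn by (simp add: norm_diff_sq_tang m2 sq)
  note bound = touching_action_bound[OF less_imp_le[OF a] sgn_tang_nth norm_sgn_tang_le pa pq w s M]
  show "ennreal (1 / 2 * (norm (x - y))\<^sup>2) \<le> action k a w"
    using ennreal_leI[OF le] bound(1) by (rule order_trans)
  assume upper: "action k a w \<le> ennreal (1 / 2 * (norm (x - y))\<^sup>2)" and t: "t \<in> {0..1}"
  \<comment> \<open>The two bounds differ by \<open>2 * (x $ k * y $ k)\<close>, so a minimizer with
    contact has an end point on the boundary.\<close>
  from bound(1) upper have "ennreal (1 / 2 * m\<^sup>2) \<le> ennreal (1 / 2 * (norm (x - y))\<^sup>2)" by (rule order_trans)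
  then have "m\<^sup>2 \<le> (norm (x - y))\<^sup>2" by (subst (asm) ennreal_le_iff) auto
  then have "x $ k * y $ k \<le> 0" by (simp add: norm_diff_sq_tang m2 sq)
  with nn have xy0: "x $ k = 0 \<or> y $ k = 0" by (metis mult_nonneg_nonneg mult_eq_0_iff antisym)
  from upper ennreal_leI[OF le] have "action k a w \<le> ennreal (1 / 2 * m\<^sup>2)" by (rule order_trans)
  then obtain t1 t2 where t12: "0 \<le> t1" "t1 \<le> t2" "t2 \<le> 1" and z: "w t1 $ k = 0" "w t2 $ k = 0"
    and eq: "\<And>t. t \<in> {0..1} \<Longrightarrow> w t = broken_path x (m *\<^sub>R (p *\<^sub>R e - q *\<^sub>R axis k 1)) ((m * p * a) *\<^sub>R e)
           (m *\<^sub>R (p *\<^sub>R e + q *\<^sub>R axis k 1)) t1 t2 t"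
    using bound(2) by blast
  have eq': "w t = broken_path x (r *\<^sub>R e - \<sigma> *\<^sub>R axis k 1) ((r * a) *\<^sub>R e) (r *\<^sub>R e + \<sigma> *\<^sub>R axis k 1) t1 t2 t"
    if "t \<in> {0..1}" for t
    unfolding eq[OF that] by (simp add: scaleR_diff_right scaleR_add_right mp mq)
  have w1: "w 1 = y" using w by (simp add: conn_def)
  have x_k: "x $ k = t1 * \<sigma>"
    using z(1) eq'[of t1] t12 by (simp add: broken_path_def sgn_tang_nth)
  have "y $ k = w 1 $ k" by (simp add: w1)
  also have "\<dots> = (1 - t2) * \<sigma>"
    by (subst eq') (use t12 x_k in \<open>simp_all add: broken_path_def sgn_tang_nth\<close>)
  finally have y_k: "y $ k = (1 - t2) * \<sigma>" .
  \<comment> \<open>For \<sigma> > 0 no time is left between the two contacts. One of the outer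
    phases is empty too, since an end point lies on the boundary, so a single segment
    remains.\<close>
  have "\<sigma> = t1 * \<sigma> + (1 - t2) * \<sigma>"
    unfolding x_k[symmetric] y_k[symmetric] by (rule \<sigma>_def)
  then have t21: "\<sigma> * (t2 - t1) = 0" by (simp add: algebra_simps)
  show "w t = (1 - t) *\<^sub>R x + t *\<^sub>R y"
  proof (cases "\<sigma> = 0")
    case True
    then have "r = 0" using flat a r_nonneg by (auto simp: \<sigma>_def mult_le_0_iff)
    moreover have "x $ k = 0" "y $ k = 0" using True nn by (auto simp: \<sigma>_def)
    ultimately have "y = x" using scaleR_sgn_tang by simp
    with eq'[OF t] show ?thesis using True \<open>r = 0\<close> by (simp add: broken_path_def algebra_simps)
  next
    case False
    with t21 have t21: "t2 = t1" by simp
    from xy0 show ?thesis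
    proof
      assume "x $ k = 0"
      with x_k False have "t1 = 0" by simp
      then have "w t = x + t *\<^sub>R (r *\<^sub>R e + \<sigma> *\<^sub>R axis k 1)" using eq'[OF t] t t21 by (simp add: broken_path_def)
      also have "r *\<^sub>R e + \<sigma> *\<^sub>R axis k 1 = y - x" using \<open>x $ k = 0\<close> by (simp add: scaleR_sgn_tang \<sigma>_def)
      finally show ?thesis by (simp add: algebra_simps)
    next
      assume "y $ k = 0"
      with y_k t21 False have "t1 = 1" by simp
      then have "w t = x + t *\<^sub>R (r *\<^sub>R e - \<sigma> *\<^sub>R axis k 1)" using eq'[OF t] t t21 by (simp add: broken_path_def)
      also have "r *\<^sub>R e - \<sigma> *\<^sub>R axis k 1 = y - x" using \<open>y $ k = 0\<close> by (simp add: scaleR_sgn_tang \<sigma>_def)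
      finally show ?thesis by (simp add: algebra_simps)
    qed
  qed
qed

section \<open>The broken line at the critical angle\<close>

context
  fixes a p q M :: real
  assumes a: "1 < a" and xy: "x \<in> halfspace k" "y \<in> halfspace k"
  defines "p \<equiv> 1 / sqrt a" and "q \<equiv> sqrt (a - 1) / sqrt a"
    and "M \<equiv> (r + sqrt (a - 1) * (x $ k + y $ k)) / sqrt a"
begin

private lemma xy_nonneg: "0 \<le> x $ k" "0 \<le> y $ k"
  using xy by (auto simp: halfspace_def)

text \<open>\<open>p\<close> and \<open>q\<close> are the sine and the cosine of the critical angle;
  both constraints of the calibration are tight.\<close>

private lemma pq:
  shows "0 < p" "0 < q" "p\<^sup>2 * a = 1" "p\<^sup>2 + q\<^sup>2 = 1" "p = q / sqrt (a - 1)" "p * a = sqrt a"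
  using a by (auto simp: p_def q_def power_divide field_simps real_div_sqrt)

private lemma M_eq: "M = p * (e \<bullet> (y - x)) + q * (x $ k + y $ k)"
  unfolding inner_sgn_tang by (simp add: M_def p_def q_def add_divide_distrib)

private lemma M_pos: "0 < r \<Longrightarrow> 0 < M"
  unfolding M_def using a xy_nonneg by (intro divide_pos_pos add_pos_nonneg) auto

lemma touching_path_eq:
  "touching_path k a x y = broken_path x (M *\<^sub>R (p *\<^sub>R e - q *\<^sub>R axis k 1)) ((M * p * a) *\<^sub>R e)
     (M *\<^sub>R (p *\<^sub>R e + q *\<^sub>R axis k 1)) (x $ k / (M * q)) (1 - y $ k / (M * q))"
  unfolding touching_path_def Let_def e_def r_def p_def q_def M_def by (rule refl)

lemma touching_lower_bound:
  assumes "w \<in> conn k x y" "s \<in> {0..1}" "w s $ k = 0"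
  shows "ennreal (1 / 2 * M\<^sup>2) \<le> action k a w"
  by (rule touching_action_bound[OF less_imp_le[OF a] sgn_tang_nth norm_sgn_tang_le _ _ assms M_eq])
    (simp_all add: pq(3,4))

text \<open>The calibration fixes the three velocities. The normal coordinate then gives
  \<open>x $ k = t1 * (M * q)\<close> and \<open>y $ k = (1 - t2) * (M * q)\<close>; since
  \<open>0 < r\<close> implies \<open>0 < M\<close>, these equations can be solved for the
  times.\<close>

lemma touching_path_unique:
  assumes w: "w \<in> conn k x y" and s: "s \<in> {0..1}" "w s $ k = 0" and r: "0 < r"
    and le: "action k a w \<le> ennreal (1 / 2 * M\<^sup>2)" and t: "t \<in> {0..1}"
  shows "w t = touching_path k a x y t"
proof -
  obtain t1 t2 where t12: "0 \<le> t1" "t1 \<le> t2" "t2 \<le> 1" and z: "w t1 $ k = 0" "w t2 $ k = 0"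
    and eq: "\<And>t. t \<in> {0..1} \<Longrightarrow> w t = broken_path x (M *\<^sub>R (p *\<^sub>R e - q *\<^sub>R axis k 1)) ((M * p * a) *\<^sub>R e)
           (M *\<^sub>R (p *\<^sub>R e + q *\<^sub>R axis k 1)) t1 t2 t"
    using touching_action_bound(2)[OF less_imp_le[OF a] sgn_tang_nth norm_sgn_tang_le _ _ w s M_eq le] pq(3,4) by auto
  have x_k: "x $ k = t1 * (M * q)"
    using z(1) eq[of t1] t12 by (simp add: broken_path_def sgn_tang_nth)
  have "y $ k = w 1 $ k" using w by (simp add: conn_def)
  also have "\<dots> = (1 - t2) * (M * q)"
    by (subst eq) (use t12 x_k in \<open>simp_all add: broken_path_def sgn_tang_nth\<close>)
  finally have y_k: "y $ k = (1 - t2) * (M * q)" .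
  have "t1 = x $ k / (M * q)" "t2 = 1 - y $ k / (M * q)"
    unfolding x_k y_k using M_pos[OF r] pq(2) by simp_all
  with eq[OF t] show ?thesis by (simp add: touching_path_eq)
qed

context
  assumes steep: "x $ k + y $ k \<le> sqrt (a - 1) * r" and r: "0 < r"
begin

private lemma Mq_pos: "0 < M * q"
  using M_pos[OF r] pq(2) by simp

text \<open>\<open>M * q\<close> is the normal speed, so the fractions are the durations of descent
  and ascent. They fit into unit time iff \<open>x $ k + y $ k \<le> M * q\<close>, which after
  clearing denominators is the steepness assumption.\<close>

lemma touching_times:
  "0 \<le> x $ k / (M * q)" "x $ k / (M * q) \<le> 1 - y $ k / (M * q)" "1 - y $ k / (M * q) \<le> 1"
proof -
  show "0 \<le> x $ k / (M * q)" "1 - y $ k / (M * q) \<le> 1"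
    using Mq_pos xy_nonneg by (auto simp: zero_le_divide_iff)
  have "M * q = (sqrt (a - 1) * r + (a - 1) * (x $ k + y $ k)) / a"
    using a by (simp add: M_def q_def field_simps)
  moreover have "(x $ k + y $ k) * a \<le> sqrt (a - 1) * r + (a - 1) * (x $ k + y $ k)"
    using steep by (simp add: algebra_simps)
  ultimately have "x $ k + y $ k \<le> M * q" using a by (simp add: pos_le_divide_eq)
  then have "(x $ k + y $ k) / (M * q) \<le> 1" using Mq_pos by simp
  then show "x $ k / (M * q) \<le> 1 - y $ k / (M * q)" by (simp add: add_divide_distrib)
qed

text \<open>The ratio of tangential to normal speed is \<open>p / q = 1 / sqrt (a - 1)\<close>, the
  tangent of the critical angle, which gives the shifts of the corners. The boundary phase has to
  cover what remains of \<open>r\<close>, and \<open>M * p * a\<close> is the speed that does it in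
  the time left.\<close>

lemma touching_corners:
  defines "t1 \<equiv> x $ k / (M * q)" and "t2 \<equiv> 1 - y $ k / (M * q)"
    and "A \<equiv> M *\<^sub>R (p *\<^sub>R e - q *\<^sub>R axis k 1)" and "C \<equiv> M *\<^sub>R (p *\<^sub>R e + q *\<^sub>R axis k 1)"
  shows "x + t1 *\<^sub>R A = tang k x + (x $ k / sqrt (a - 1)) *\<^sub>R e"
    and "x + t1 *\<^sub>R A + (t2 - t1) *\<^sub>R ((M * p * a) *\<^sub>R e) = tang k y - (y $ k / sqrt (a - 1)) *\<^sub>R e"
    and "x + t1 *\<^sub>R A + (t2 - t1) *\<^sub>R ((M * p * a) *\<^sub>R e) + (1 - t2) *\<^sub>R C = y"
proof -
  have q_p: "p = q / sqrt (a - 1)" by (rule pq(5))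
  have Mp: "M * p = M * q / sqrt (a - 1)" by (simp add: q_p)
  have t1: "t1 * (M * q) = x $ k" and t2: "(1 - t2) * (M * q) = y $ k"
    using M_pos[OF r] pq(2) by (simp_all add: t1_def t2_def)
  have t1': "t1 * (M * p) = x $ k / sqrt (a - 1)" and t2': "(1 - t2) * (M * p) = y $ k / sqrt (a - 1)"
    unfolding Mp using t1 t2 by simp_all
  have tA: "t1 *\<^sub>R A = (t1 * (M * p)) *\<^sub>R e - (t1 * (M * q)) *\<^sub>R axis k 1"
    by (simp add: A_def algebra_simps)
  show 1: "x + t1 *\<^sub>R A = tang k x + (x $ k / sqrt (a - 1)) *\<^sub>R e"
    unfolding tA t1 t1' by (simp add: tang_eq)
  have "M * p * a = M * sqrt a" using pq(6) by (simp add: mult.assoc)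
  also have "\<dots> = r + sqrt (a - 1) * (x $ k + y $ k)" using a by (simp add: M_def)
  finally have Mpa: "M * p * a = r + sqrt (a - 1) * (x $ k + y $ k)" .
  \<comment> \<open>Writing \<open>t2 - t1\<close> as \<open>1 - t1 - (1 - t2)\<close> expresses the
    boundary displacement through the two known shifts.\<close>
  have "(t2 - t1) * (M * p * a) = (M * p * a) - a * (t1 * (M * p) + (1 - t2) * (M * p))"
    by (simp add: algebra_simps)
  also have "\<dots> = r - (x $ k / sqrt (a - 1) + y $ k / sqrt (a - 1))"
  proof -
    have s: "sqrt (a - 1) * sqrt (a - 1) = a - 1" using a by simp
    have "sqrt (a - 1) * u = (a - 1) * (u / sqrt (a - 1))" for u
    proof -
      have "(a - 1) * (u / sqrt (a - 1)) = (sqrt (a - 1) * sqrt (a - 1)) * (u / sqrt (a - 1))"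
        by (simp only: s)
      also have "\<dots> = sqrt (a - 1) * u" using a by (simp del: real_sqrt_mult_self)
      finally show ?thesis by (rule sym)
    qed
    from this[of "x $ k + y $ k"]
    have eq: "sqrt (a - 1) * (x $ k + y $ k) = (a - 1) * (x $ k / sqrt (a - 1) + y $ k / sqrt (a - 1))"
      by (simp only: add_divide_distrib)
    have "r + (a - 1) * z - a * z = r - z" for z by (simp add: algebra_simps)
    then show ?thesis unfolding Mpa t1' t2' eq .
  qed
  finally have B: "(t2 - t1) * (M * p * a) = r - (x $ k / sqrt (a - 1) + y $ k / sqrt (a - 1))" .
  show 2: "x + t1 *\<^sub>R A + (t2 - t1) *\<^sub>R ((M * p * a) *\<^sub>R e) = tang k y - (y $ k / sqrt (a - 1)) *\<^sub>R e"
    unfolding 1 scaleR_scaleR B by (simp add: tang_eq scaleR_left_diff_distrib scaleR_left_distrib scaleR_sgn_tang)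
  have tC: "(1 - t2) *\<^sub>R C = ((1 - t2) * (M * p)) *\<^sub>R e + ((1 - t2) * (M * q)) *\<^sub>R axis k 1"
    by (simp add: C_def algebra_simps)
  show "x + t1 *\<^sub>R A + (t2 - t1) *\<^sub>R ((M * p * a) *\<^sub>R e) + (1 - t2) *\<^sub>R C = y"
    unfolding 2 tC t2 t2' by (simp add: tang_eq)
qed

lemma touching_path_nth:
  assumes "t \<in> {0..1}"
  shows "touching_path k a x y t $ k =
    (if t < x $ k / (M * q) then x $ k - t * (M * q)
     else if t \<le> 1 - y $ k / (M * q) then 0 else (t - (1 - y $ k / (M * q))) * (M * q))"
  using Mq_pos touching_times by (auto simp: touching_path_eq broken_path_def sgn_tang_nth)

lemma touching_path_in_conn: "touching_path k a x y \<in> conn k x y"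
proof -
  have "touching_path k a x y \<in> H1"
    unfolding touching_path_eq by (rule has_velocity_imp_H1[OF has_velocity_broken_path[OF touching_times(1,2)]])
  moreover have "touching_path k a x y t \<in> halfspace k" if "t \<in> {0..1}" for t
    using touching_path_nth[OF that] Mq_pos by (auto simp: halfspace_def field_simps)
  moreover have "touching_path k a x y 0 = x"
    unfolding touching_path_eq using touching_times by (auto simp: broken_path_def)
  moreover have "touching_path k a x y 1 = y"
    unfolding touching_path_eq using touching_times touching_corners(3) by (auto simp: broken_path_def)
  ultimately show ?thesis by (auto simp: conn_def H1_halfspace_def)
qed

text \<open>The parametrisation equalises the costs: speed at most \<open>M\<close> at weight
  \<open>1 / 2\<close> in the outer phases, at most \<open>sqrt a * M\<close> at weight
  \<open>1 / (2 * a)\<close> on the boundary.\<close>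

lemma action_touching_path_le: "action k a (touching_path k a x y) \<le> ennreal (1 / 2 * M\<^sup>2)"
  unfolding touching_path_eq
proof (rule action_le_const[OF has_velocity_broken_path[OF touching_times(1,2)]])
  fix t :: real assume t: "t \<in> {0..1}"
  let ?n = "axis k 1 :: real ^ 'n"
  let ?t1 = "x $ k / (M * q)" and ?t2 = "1 - y $ k / (M * q)"
  let ?A = "M *\<^sub>R (p *\<^sub>R e - q *\<^sub>R ?n)" and ?B = "(M * p * a) *\<^sub>R e" and ?C = "M *\<^sub>R (p *\<^sub>R e + q *\<^sub>R ?n)"
  have ne: "?n \<bullet> u = u $ k" "u \<bullet> ?n = u $ k" for u by (simp_all add: inner_axis inner_axis')
  have e2: "e \<bullet> e \<le> 1" using norm_sgn_tang_le by (simp flip: power2_norm_eq_inner add: power_le_one)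
  have "p\<^sup>2 * (e \<bullet> e) + q\<^sup>2 \<le> 1" using mult_left_mono[OF e2, of "p\<^sup>2"] pq(4) by simp
  moreover have "(norm (p *\<^sub>R e - q *\<^sub>R ?n))\<^sup>2 = p\<^sup>2 * (e \<bullet> e) + q\<^sup>2" "(norm (p *\<^sub>R e + q *\<^sub>R ?n))\<^sup>2 = p\<^sup>2 * (e \<bullet> e) + q\<^sup>2"
    unfolding power2_norm_eq_inner by (simp_all add: inner_simps ne sgn_tang_nth power2_eq_square)
  ultimately have AC: "1 / 2 * (norm ?A)\<^sup>2 \<le> 1 / 2 * M\<^sup>2" "1 / 2 * (norm ?C)\<^sup>2 \<le> 1 / 2 * M\<^sup>2"
    by (simp_all add: power_mult_distrib mult_left_le)
  have "(norm ?B)\<^sup>2 = a * ((p\<^sup>2 * a) * (M\<^sup>2 * (e \<bullet> e)))"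
    unfolding power2_norm_eq_inner by (simp add: power2_eq_square)
  then have B: "(norm ?B)\<^sup>2 \<le> a * M\<^sup>2"
    unfolding pq(3) using a e2 by (simp add: mult_left_le)
  consider "t < ?t1" | "?t1 \<le> t" "t \<le> ?t2" | "?t2 < t" by linarith
  then show "lagrangian k a (broken_path x ?A ?B ?C ?t1 ?t2 t) (broken_velocity ?A ?B ?C ?t1 ?t2 t) \<le> 1 / 2 * M\<^sup>2"
  proof cases
    case 1
    then have "broken_velocity ?A ?B ?C ?t1 ?t2 t = ?A" by (simp add: broken_velocity_def)
    then show ?thesis by (simp only:) (rule order_trans[OF lagrangian_le AC(1)])
  next
    case 2
    then have "broken_velocity ?A ?B ?C ?t1 ?t2 t = ?B" by (simp add: broken_velocity_def)
    moreover have "broken_path x ?A ?B ?C ?t1 ?t2 t \<in> bdry k"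
      using 2 touching_path_nth[OF t] by (simp add: touching_path_eq bdry_def)
    ultimately show ?thesis using a B by (simp add: lagrangian_def field_simps)
  next
    case 3
    then have "broken_velocity ?A ?B ?C ?t1 ?t2 t = ?C" using touching_times(2) by (simp add: broken_velocity_def)
    then show ?thesis by (simp only:) (rule order_trans[OF lagrangian_le AC(2)])
  qed
qed

lemma touching_path_three_segments:
  assumes "tan \<alpha> = 1 / sqrt (a - 1)"
  shows "three_segments k \<alpha> x y (touching_path k a x y)"
proof -
  have z: "z_in k \<alpha> x y = tang k x + (x $ k / sqrt (a - 1)) *\<^sub>R e"
    "z_out k \<alpha> x y = tang k y - (y $ k / sqrt (a - 1)) *\<^sub>R e"
    by (simp_all add: z_in_def z_out_def assms e_def)
  have "straight_on (touching_path k a x y) 0 (x $ k / (M * q)) x (z_in k \<alpha> x y)"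
    unfolding touching_path_eq z touching_corners(1)[symmetric]
    by (rule straight_on_broken_path(1)[OF touching_times])
  moreover have "straight_on (touching_path k a x y) (x $ k / (M * q)) (1 - y $ k / (M * q))
      (z_in k \<alpha> x y) (z_out k \<alpha> x y)"
    unfolding touching_path_eq z touching_corners(1)[symmetric] touching_corners(2)[symmetric]
    by (rule straight_on_broken_path(2)[OF touching_times])
  moreover have "straight_on (touching_path k a x y) (1 - y $ k / (M * q)) 1 (z_out k \<alpha> x y) y"
    using straight_on_broken_path(3)[OF touching_times, of x "M *\<^sub>R (p *\<^sub>R e - q *\<^sub>R axis k 1)" "(M * p * a) *\<^sub>R e"
      "M *\<^sub>R (p *\<^sub>R e + q *\<^sub>R axis k 1)", unfolded touching_corners(3)]
    unfolding touching_path_eq z touching_corners(2)[symmetric] .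
  ultimately show ?thesis
    using touching_times unfolding three_segments_def
    by (intro exI[of _ "x $ k / (M * q)"] exI[of _ "1 - y $ k / (M * q)"]) auto
qed

end

end

end

section \<open>Geodesics\<close>

text \<open>Once a lower bound is attained, being a minimizer becomes an upper bound on the action,
  the form in which the rigidity results take it.\<close>

lemma geodesic_iff_le:
  assumes "g \<in> conn k x y" "action k a g \<le> ennreal c" "\<And>w. w \<in> conn k x y \<Longrightarrow> ennreal c \<le> action k a w"
  shows "geodesic k a x y w \<longleftrightarrow> w \<in> conn k x y \<and> action k a w \<le> ennreal c"
  using assms unfolding geodesic_def by (meson order_trans)

section \<open>Comparison of the straight and the broken line for \<open>a > 1\<close>\<close>

context
  fixes k :: "'n::finite" and x y :: "real ^ 'n" and a c1 c2 :: real
  assumes a: "1 < a" and x: "x \<in> halfspace k" and y: "y \<in> halfspace k"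
  defines "c1 \<equiv> 1 / 2 * (norm (x - y))\<^sup>2"
    and "c2 \<equiv> 1 / 2 * ((norm (tang k y - tang k x) + sqrt (a - 1) * (x $ k + y $ k)) / sqrt a)\<^sup>2"
begin

private abbreviation "r \<equiv> norm (tang k y - tang k x)"
private abbreviation "h \<equiv> 2 * sqrt a * sqrt (x $ k * y $ k)"
private abbreviation "D \<equiv> sqrt (a - 1) * r - (x $ k + y $ k)"

private lemma coords_nonneg: "0 \<le> x $ k" "0 \<le> y $ k"
  using x y by (auto simp: halfspace_def)

private lemma h_nonneg: "0 \<le> h"
  using a coords_nonneg by (intro mult_nonneg_nonneg) auto

private lemma h_sq: "h\<^sup>2 = 4 * a * (x $ k * y $ k)"
  using a coords_nonneg by (simp add: power_mult_distrib)

text \<open>Decides which of the two curves is cheaper as long as \<open>0 \<le> D\<close>. For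
  \<open>D < - h\<close> the identity gives \<open>c2 < c1\<close>, yet the phases of the broken
  line do not fit into unit time; hence \<open>frakC\<close> is the one-sided condition
  \<open>D \<le> h\<close>.\<close>

lemma straight_minus_touching_cost: "2 * a * (c1 - c2) = D\<^sup>2 - h\<^sup>2"
proof -
  define R where "R = sqrt (a - 1)"
  have R: "R\<^sup>2 = a - 1" using a by (simp add: R_def)
  have c2: "2 * a * c2 = (r + R * (x $ k + y $ k))\<^sup>2"
    using a by (simp add: c2_def R_def power_divide)
  have c1: "2 * a * c1 = a * (r\<^sup>2 + (x $ k - y $ k)\<^sup>2)"
    by (simp add: c1_def norm_diff_sq_tang)
  have "a * (r\<^sup>2 + (x $ k - y $ k)\<^sup>2) - (r + R * (x $ k + y $ k))\<^sup>2 =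
      (R * r - (x $ k + y $ k))\<^sup>2 - 4 * a * (x $ k * y $ k)"
  proof -
    have a_eq: "a = R\<^sup>2 + 1" using R by simp
    show ?thesis unfolding a_eq by (simp add: power2_eq_square algebra_simps)
  qed
  then show ?thesis unfolding h_sq right_diff_distrib c1 c2 by (simp only: R_def)
qed

private lemma threshold_eq: "sqrt (a - 1) * threshold k a x y = x $ k + y $ k + h"
  using a coords_nonneg by (simp add: threshold_def)

lemma frakC_iff: "(x, y) \<in> frakC k a \<longleftrightarrow> D \<le> h"
proof -
  have "r \<le> threshold k a x y \<longleftrightarrow> sqrt (a - 1) * r \<le> sqrt (a - 1) * threshold k a x y"
    using a by simp
  then show ?thesis using x y by (auto simp: frakC_def threshold_eq)
qed

lemma cut_pairs_iff: "(x, y) \<in> cut_pairs k a \<longleftrightarrow> 0 < x $ k \<and> 0 < y $ k \<and> D = h"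
proof -
  have "r = threshold k a x y \<longleftrightarrow> sqrt (a - 1) * r = sqrt (a - 1) * threshold k a x y"
    using a by simp
  then show ?thesis using a by (auto simp: cut_pairs_def threshold_eq)
qed

lemma static_cost_eq: "static_cost k a x y = (if (x, y) \<in> frakC k a then c1 else c2)"
  using a coords_nonneg by (simp add: static_cost_def c1_def c2_def power_divide add.commute)

lemma steep_imp_r_pos:
  assumes "0 < D"
  shows "0 < r"
proof -
  have "0 < sqrt (a - 1) * r" using assms coords_nonneg by linarith
  then show ?thesis by (simp add: zero_less_mult_iff)
qed

text \<open>Without contact the straight bound applies, with contact and \<open>D \<le> 0\<close>
  the mirror-image bound. In the remaining range \<open>0 < D \<le> h\<close> touching costs at
  least \<open>c2 \<ge> c1\<close>, with \<open>c1 = c2\<close> only at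
  \<open>D = h\<close>.\<close>

lemma frakC_lower_bound:
  assumes C: "(x, y) \<in> frakC k a" and w: "w \<in> conn k x y"
  shows "ennreal c1 \<le> action k a w"
    and "action k a w \<le> ennreal c1 \<Longrightarrow> (\<forall>t\<in>{0..1}. w t = (1 - t) *\<^sub>R x + t *\<^sub>R y) \<or>
      (x, y) \<in> cut_pairs k a \<and> (\<forall>t\<in>{0..1}. w t = touching_path k a x y t)"
proof -
  have "ennreal c1 \<le> action k a w \<and> (action k a w \<le> ennreal c1 \<longrightarrow>
      (\<forall>t\<in>{0..1}. w t = (1 - t) *\<^sub>R x + t *\<^sub>R y) \<or>
      (x, y) \<in> cut_pairs k a \<and> (\<forall>t\<in>{0..1}. w t = touching_path k a x y t))"
  proof (cases "\<exists>s\<in>{0..1}. w s $ k = 0")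
    case False
    then show ?thesis
      using straight_action_bound[OF w, of a] unfolding c1_def by blast
  next
    case True
    then obtain s where s: "s \<in> {0..1}" "w s $ k = 0" by blast
    show ?thesis
    proof (cases "D \<le> 0")
      case True
      then have flat: "sqrt (a - 1) * r \<le> x $ k + y $ k" by simp
      show ?thesis
        using flat_touching_action_bound[OF a x y flat w s] unfolding c1_def by blast
    next
      case False
      then have D: "0 < D" "D \<le> h" using C by (auto simp: frakC_iff)
      then have "D\<^sup>2 \<le> h\<^sup>2" by (intro power_mono) auto
      with straight_minus_touching_cost have "2 * a * (c1 - c2) \<le> 0" by simp
      then have c: "c1 \<le> c2" using a by (simp add: mult_le_0_iff)
      have c2: "ennreal c2 \<le> action k a w"
        unfolding c2_def by (rule touching_lower_bound[OF a x y w s])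
      have "(x, y) \<in> cut_pairs k a \<and> (\<forall>t\<in>{0..1}. w t = touching_path k a x y t)"
        if le: "action k a w \<le> ennreal c1"
      proof
        \<comment> \<open>The action lies above \<open>c2 \<ge> c1\<close> and below
          \<open>c1\<close>; hence \<open>D = h\<close>, and \<open>h > 0\<close> puts both end
          points in the interior.\<close>
        from c2 le have "ennreal c2 \<le> ennreal c1" by (rule order_trans)
        then have "c2 \<le> c1" by (subst (asm) ennreal_le_iff) (auto simp: c1_def)
        with c have "D\<^sup>2 = h\<^sup>2" using straight_minus_touching_cost by simp
        then have eq: "D = h" using D h_nonneg by (simp add: power2_eq_iff_nonneg)
        with D(1) have "x $ k * y $ k \<noteq> 0" by auto
        with eq coords_nonneg show "(x, y) \<in> cut_pairs k a"
          unfolding cut_pairs_iff by (auto simp: less_le)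
        have "action k a w \<le> ennreal c2" using le c by (meson ennreal_leI order_trans)
        then show "\<forall>t\<in>{0..1}. w t = touching_path k a x y t"
          using touching_path_unique[OF a x y w s steep_imp_r_pos[OF D(1)]] unfolding c2_def by blast
      qed
      with c c2 show ?thesis by (meson ennreal_leI order_trans)
    qed
  qed
  then show "ennreal c1 \<le> action k a w"
    and "action k a w \<le> ennreal c1 \<Longrightarrow> (\<forall>t\<in>{0..1}. w t = (1 - t) *\<^sub>R x + t *\<^sub>R y) \<or>
      (x, y) \<in> cut_pairs k a \<and> (\<forall>t\<in>{0..1}. w t = touching_path k a x y t)"
    by blast+
qed

lemma not_frakC_steep: "(x, y) \<notin> frakC k a \<Longrightarrow> 0 < D"
  unfolding frakC_iff using h_nonneg by linarith

text \<open>\<open>h < D\<close> gives \<open>c2 < c1\<close>, so curves without contact are too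
  expensive and a minimizer must touch the boundary.\<close>

lemma not_frakC_lower_bound:
  assumes C: "(x, y) \<notin> frakC k a" and w: "w \<in> conn k x y"
  shows "ennreal c2 \<le> action k a w"
    and "action k a w \<le> ennreal c2 \<Longrightarrow> t \<in> {0..1} \<Longrightarrow> w t = touching_path k a x y t"
proof -
  have "h < D" using C by (simp add: frakC_iff)
  then have "h\<^sup>2 < D\<^sup>2" using h_nonneg by (intro power_strict_mono) auto
  with straight_minus_touching_cost have "0 < 2 * a * (c1 - c2)" by simp
  then have c: "c2 < c1" using a by (simp add: zero_less_mult_iff)
  have c0: "0 \<le> c2" by (simp add: c2_def)
  have "ennreal c2 \<le> action k a w \<and> (action k a w \<le> ennreal c2 \<longrightarrow>
      (\<forall>t\<in>{0..1}. w t = touching_path k a x y t))"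
  proof (cases "\<exists>s\<in>{0..1}. w s $ k = 0")
    case False
    then have "ennreal c1 \<le> action k a w"
      using straight_action_bound(1)[OF w, of a] unfolding c1_def by blast
    moreover have "ennreal c2 < ennreal c1" using c c0 by (simp add: ennreal_less_iff)
    ultimately have "ennreal c2 < action k a w" by (rule order_less_le_trans[rotated])
    then show ?thesis by (simp add: not_le[symmetric] less_imp_le)
  next
    case True
    then obtain s where s: "s \<in> {0..1}" "w s $ k = 0" by blast
    show ?thesis
      using touching_lower_bound[OF a x y w s]
        touching_path_unique[OF a x y w s steep_imp_r_pos[OF not_frakC_steep[OF C]]]
      unfolding c2_def by blast
  qed
  then show "ennreal c2 \<le> action k a w"
    and "action k a w \<le> ennreal c2 \<Longrightarrow> t \<in> {0..1} \<Longrightarrow> w t = touching_path k a x y t"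
    by blast+
qed

lemma steep_touching_path:
  assumes "0 < D"
  shows "touching_path k a x y \<in> conn k x y" "action k a (touching_path k a x y) \<le> ennreal c2"
    and "tan \<alpha> = 1 / sqrt (a - 1) \<Longrightarrow> three_segments k \<alpha> x y (touching_path k a x y)"
proof -
  have st: "x $ k + y $ k \<le> sqrt (a - 1) * r" using assms by simp
  note h = a x y st steep_imp_r_pos[OF assms]
  show "touching_path k a x y \<in> conn k x y" by (rule touching_path_in_conn[OF h])
  show "action k a (touching_path k a x y) \<le> ennreal c2"
    unfolding c2_def by (rule action_touching_path_le[OF h])
  show "tan \<alpha> = 1 / sqrt (a - 1) \<Longrightarrow> three_segments k \<alpha> x y (touching_path k a x y)"
    by (rule touching_path_three_segments[OF h])
qed

lemma geodesic_in_frakC: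
  assumes C: "(x, y) \<in> frakC k a"
  shows "geodesic k a x y w \<longleftrightarrow> w \<in> conn k x y \<and> action k a w \<le> ennreal c1"
  by (rule geodesic_iff_le[OF line_in_conn[OF x y] _ frakC_lower_bound(1)[OF C]])
    (simp_all add: c1_def action_line_le del: times_divide_eq_left)

lemma geodesic_not_in_frakC:
  assumes C: "(x, y) \<notin> frakC k a"
  shows "geodesic k a x y w \<longleftrightarrow> w \<in> conn k x y \<and> action k a w \<le> ennreal c2"
  by (rule geodesic_iff_le[OF steep_touching_path(1,2)[OF not_frakC_steep[OF C]] not_frakC_lower_bound(1)[OF C]])

text \<open>\<open>D = h\<close> gives \<open>c1 = c2\<close>, and \<open>h > 0\<close> makes the
  broken line admissible: a second minimizer next to the straight line.\<close>

lemma cut_pairs_geodesic: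
  assumes cut: "(x, y) \<in> cut_pairs k a"
  shows "0 < D" "(x, y) \<in> frakC k a" "geodesic k a x y (touching_path k a x y)"
proof -
  have D: "0 < x $ k" "0 < y $ k" "D = h" using cut by (auto simp: cut_pairs_iff)
  have "0 < h" using D a by simp
  with D show D0: "0 < D" by simp
  show C: "(x, y) \<in> frakC k a" using D by (simp add: frakC_iff)
  have "c2 = c1" using straight_minus_touching_cost D a by simp
  then show "geodesic k a x y (touching_path k a x y)"
    using steep_touching_path[OF D0] by (simp add: geodesic_in_frakC[OF C])
qed

lemma static_cost_attained:
  "ennreal (static_cost k a x y) \<in> action k a ` conn k x y"
  "w \<in> conn k x y \<Longrightarrow> ennreal (static_cost k a x y) \<le> action k a w"
proof -
  show "w \<in> conn k x y \<Longrightarrow> ennreal (static_cost k a x y) \<le> action k a w" for w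
    using frakC_lower_bound(1)[of w] not_frakC_lower_bound(1)[of w] by (simp add: static_cost_eq)
  moreover obtain g where "g \<in> conn k x y" "action k a g \<le> ennreal (static_cost k a x y)"
  proof (cases "(x, y) \<in> frakC k a")
    case True
    then show ?thesis
      using that[OF line_in_conn[OF x y]] action_line_le[of k a x y] by (simp add: static_cost_eq c1_def)
  next
    case False
    then show ?thesis
      using steep_touching_path(1,2)[OF not_frakC_steep[OF False]]
      by (intro that[of "touching_path k a x y"]) (simp_all add: static_cost_eq)
  qed
  ultimately show "ennreal (static_cost k a x y) \<in> action k a ` conn k x y"
    by (metis antisym imageI)
qed

lemma geodesic_essentially_unique:
  "\<exists>g. geodesic k a x y g \<and>
    ((x, y) \<notin> cut_pairs k a \<longrightarrow> (\<forall>h. geodesic k a x y h \<longrightarrow> (\<forall>t\<in>{0..1}. h t = g t)))"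
proof (cases "(x, y) \<in> frakC k a")
  case True
  have "geodesic k a x y (\<lambda>t. (1 - t) *\<^sub>R x + t *\<^sub>R y)"
    unfolding geodesic_in_frakC[OF True] using line_in_conn[OF x y] action_line_le[of k a x y] by (simp add: c1_def)
  then show ?thesis
    using frakC_lower_bound(2)[OF True] by (auto simp: geodesic_in_frakC[OF True])
next
  case False
  then show ?thesis
    using steep_touching_path(1,2)[OF not_frakC_steep[OF False]] not_frakC_lower_bound(2)[OF False]
    unfolding geodesic_not_in_frakC[OF False] by blast
qed

section \<open>The contact angle\<close>

context
  fixes \<alpha> :: real
  assumes \<alpha>: "0 < \<alpha>" "\<alpha> < pi / 2" "(sin \<alpha>)\<^sup>2 = 1 / a"
begin

private lemma cos_pos: "0 < cos \<alpha>"
  using \<alpha> by (intro cos_gt_zero_pi) auto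

lemma tan_critical_angle: "tan \<alpha> = 1 / sqrt (a - 1)"
proof -
  have s: "0 < sin \<alpha>" using \<alpha> by (intro sin_gt_zero) auto
  have "(cos \<alpha>)\<^sup>2 = (a - 1) / a" using \<alpha>(3) a by (simp add: cos_squared_eq field_simps)
  then have "(tan \<alpha>)\<^sup>2 = (1 / sqrt (a - 1))\<^sup>2"
    using a \<alpha>(3) cos_pos by (simp add: tan_def power_divide)
  moreover have "0 \<le> tan \<alpha>" using s cos_pos by (simp add: tan_def)
  ultimately show ?thesis using a by (simp add: power2_eq_iff_nonneg)
qed

text \<open>The vector has length \<open>c / cos \<alpha>\<close> and normal component
  \<open>c\<close>, so the cosine of the angle is \<open>cos \<alpha>\<close>.\<close>

lemma angle_normal:
  fixes u :: "real ^ 'n"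
  assumes c: "0 < c" and u: "u $ k = 0" "norm u = 1"
  shows "angle (c *\<^sub>R axis k 1 + (c * tan \<alpha>) *\<^sub>R u) (axis k 1) = \<alpha>"
proof -
  let ?v = "c *\<^sub>R axis k 1 + (c * tan \<alpha>) *\<^sub>R u"
  have uu: "u \<bullet> u = 1" using u(2) by (simp flip: power2_norm_eq_inner)
  have "(norm ?v)\<^sup>2 = c\<^sup>2 * (1 + (tan \<alpha>)\<^sup>2)"
    unfolding power2_norm_eq_inner using u(1)
    by (simp add: inner_simps inner_axis inner_axis' uu power2_eq_square distrib_left)
  also have "1 + (tan \<alpha>)\<^sup>2 = (inverse (cos \<alpha>))\<^sup>2"
    using cos_pos by (intro tan_sec) simp
  also have "c\<^sup>2 * (inverse (cos \<alpha>))\<^sup>2 = (c / cos \<alpha>)\<^sup>2"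
    by (simp add: power_mult_distrib divide_inverse)
  finally have "norm ?v = c / cos \<alpha>"
    using c cos_pos by (simp add: power2_eq_iff_nonneg)
  moreover have "?v \<bullet> axis k 1 = c" using u(1) by (simp add: inner_simps inner_axis)
  ultimately show ?thesis
    using c cos_pos \<alpha> by (simp add: angle_def arccos_cos)
qed

lemma geodesics_not_in_frakC:
  assumes C: "(x, y) \<notin> frakC k a"
  shows "z_in k \<alpha> x y \<in> bdry k" "z_out k \<alpha> x y \<in> bdry k"
    and "0 < x $ k \<Longrightarrow> angle (x - z_in k \<alpha> x y) (axis k 1) = \<alpha>"
    and "0 < y $ k \<Longrightarrow> angle (y - z_out k \<alpha> x y) (axis k 1) = \<alpha>"
    and "x $ k = 0 \<Longrightarrow> z_in k \<alpha> x y = x" "y $ k = 0 \<Longrightarrow> z_out k \<alpha> x y = y"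
    and "closed_segment (z_in k \<alpha> x y) (z_out k \<alpha> x y) \<subseteq> bdry k"
    and "geodesic k a x y g \<Longrightarrow> three_segments k \<alpha> x y g"
proof -
  let ?e = "sgn (tang k y - tang k x)"
  have ne: "norm ?e = 1" using steep_imp_r_pos[OF not_frakC_steep[OF C]] by (simp add: norm_sgn)
  show b: "z_in k \<alpha> x y \<in> bdry k" "z_out k \<alpha> x y \<in> bdry k"
    by (simp_all add: bdry_def z_in_def z_out_def tang_nth sgn_tang_nth)
  \<comment> \<open>Seen from the boundary, \<open>x\<close> lies against the direction of travel
    \<open>?e\<close> and \<open>y\<close> along it; hence the sign.\<close>
  have "x - z_in k \<alpha> x y = x $ k *\<^sub>R axis k 1 + (x $ k * tan \<alpha>) *\<^sub>R (- ?e)"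
    by (simp add: z_in_def tang_eq[of k x])
  then show "0 < x $ k \<Longrightarrow> angle (x - z_in k \<alpha> x y) (axis k 1) = \<alpha>"
    using angle_normal[of "x $ k" "- ?e"] ne by (simp add: sgn_tang_nth)
  have "y - z_out k \<alpha> x y = y $ k *\<^sub>R axis k 1 + (y $ k * tan \<alpha>) *\<^sub>R ?e"
    by (simp add: z_out_def tang_eq[of k y])
  then show "0 < y $ k \<Longrightarrow> angle (y - z_out k \<alpha> x y) (axis k 1) = \<alpha>"
    using angle_normal[of "y $ k" ?e] ne by (simp add: sgn_tang_nth)
  show "x $ k = 0 \<Longrightarrow> z_in k \<alpha> x y = x" "y $ k = 0 \<Longrightarrow> z_out k \<alpha> x y = y"
    by (simp_all add: z_in_def z_out_def tang_eq)
  have "convex (bdry k :: (real ^ 'n) set)" by (auto simp: convex_def bdry_def)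
  with b show "closed_segment (z_in k \<alpha> x y) (z_out k \<alpha> x y) \<subseteq> bdry k"
    by (rule closed_segment_subset)
  show "geodesic k a x y g \<Longrightarrow> three_segments k \<alpha> x y g"
    using three_segments_cong[OF steep_touching_path(3)[OF not_frakC_steep[OF C] tan_critical_angle], of g]
      not_frakC_lower_bound(2)[OF C] by (auto simp: geodesic_not_in_frakC[OF C])
qed

lemma geodesics_in_frakC:
  assumes C: "(x, y) \<in> frakC k a"
  shows "geodesic k a x y (\<lambda>t. (1 - t) *\<^sub>R x + t *\<^sub>R y)"
    and "geodesic k a x y g \<Longrightarrow> (\<forall>t\<in>{0..1}. g t = (1 - t) *\<^sub>R x + t *\<^sub>R y) \<or>
      (x, y) \<in> cut_pairs k a \<and> three_segments k \<alpha> x y g"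
proof -
  show "geodesic k a x y (\<lambda>t. (1 - t) *\<^sub>R x + t *\<^sub>R y)"
    unfolding geodesic_in_frakC[OF C] using line_in_conn[OF x y] action_line_le[of k a x y] by (simp add: c1_def)
  assume "geodesic k a x y g"
  then consider "\<forall>t\<in>{0..1}. g t = (1 - t) *\<^sub>R x + t *\<^sub>R y"
    | "(x, y) \<in> cut_pairs k a" "\<forall>t\<in>{0..1}. g t = touching_path k a x y t"
    using frakC_lower_bound(2)[OF C, of g] by (auto simp: geodesic_in_frakC[OF C])
  then show "(\<forall>t\<in>{0..1}. g t = (1 - t) *\<^sub>R x + t *\<^sub>R y) \<or>
      (x, y) \<in> cut_pairs k a \<and> three_segments k \<alpha> x y g"
  proof cases
    case 2
    then show ?thesis
      using three_segments_cong[OF steep_touching_path(3)[OF cut_pairs_geodesic(1) tan_critical_angle]] by blast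
  qed blast
qed

lemma cut_pairs_three_segments:
  assumes "(x, y) \<in> cut_pairs k a"
  shows "\<exists>g. geodesic k a x y g \<and> three_segments k \<alpha> x y g"
  using cut_pairs_geodesic(3)[OF assms] steep_touching_path(3)[OF cut_pairs_geodesic(1)[OF assms] tan_critical_angle]
  by (intro exI conjI)

end

end

text \<open>For \<open>a \<le> 1\<close> the boundary has no cheaper weight, so the straight bound
  covers curves with contact as well.\<close>

lemma minimizers_no_boundary_gain:
  fixes x y :: "real ^ 'n::finite"
  assumes a: "a \<le> 1" and x: "x \<in> halfspace k" and y: "y \<in> halfspace k"
  shows "w \<in> conn k x y \<Longrightarrow> ennreal (static_cost k a x y) \<le> action k a w"
    and "ennreal (static_cost k a x y) \<in> action k a ` conn k x y"
    and "geodesic k a x y (\<lambda>t. (1 - t) *\<^sub>R x + t *\<^sub>R y)"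
    and "geodesic k a x y g \<Longrightarrow> t \<in> {0..1} \<Longrightarrow> g t = (1 - t) *\<^sub>R x + t *\<^sub>R y"
proof -
  have c: "static_cost k a x y = 1 / 2 * (norm (x - y))\<^sup>2" using a by (simp add: static_cost_def)
  show lower: "ennreal (static_cost k a x y) \<le> action k a w" if "w \<in> conn k x y" for w
    unfolding c using straight_action_bound(1)[OF that] a by blast
  note line = line_in_conn[OF x y]
  have upper: "action k a (\<lambda>t. (1 - t) *\<^sub>R x + t *\<^sub>R y) \<le> ennreal (static_cost k a x y)"
    unfolding c by (rule action_line_le)
  show "ennreal (static_cost k a x y) \<in> action k a ` conn k x y"
    unfolding antisym[OF lower[OF line] upper] by (rule imageI[OF line])
  have iff: "geodesic k a x y w \<longleftrightarrow> w \<in> conn k x y \<and> action k a w \<le> ennreal (static_cost k a x y)" for w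
    by (rule geodesic_iff_le[OF line upper lower])
  show "geodesic k a x y (\<lambda>t. (1 - t) *\<^sub>R x + t *\<^sub>R y)"
    unfolding iff using line upper by blast
  show "geodesic k a x y g \<Longrightarrow> t \<in> {0..1} \<Longrightarrow> g t = (1 - t) *\<^sub>R x + t *\<^sub>R y"
    unfolding iff c using straight_action_bound(2) a by blast
qed

text \<open>Uniqueness is asserted off the cut pairs. On a cut pair the straight line stays in the
  interior while the broken line touches the boundary, at the same cost; the last clauses say that
  every geodesic then has one of these two shapes and that both occur.\<close>

theorem theorem6p1:
  fixes k :: "'n::finite" and a :: real
  assumes "0 < a"
  shows
    "lower_semicontinuous_map (subtopology weak_H1 (H1_halfspace k)) (dyn_cost k a) \<and>
     (\<exists>\<kappa>>0. \<forall>w\<in>H1_halfspace k. ennreal (\<kappa> * energy w) \<le> dyn_cost k a w) \<and>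
     (\<forall>x\<in>halfspace k. \<forall>y\<in>halfspace k.
        ennreal (static_cost k a x y) \<in> action k a ` conn k x y \<and>
        (\<forall>w\<in>conn k x y. ennreal (static_cost k a x y) \<le> action k a w) \<and>
        (\<exists>g. geodesic k a x y g \<and>
           ((x, y) \<notin> cut_pairs k a \<longrightarrow>
              (\<forall>h. geodesic k a x y h \<longrightarrow> (\<forall>t\<in>{0..1}. h t = g t)))) \<and>
        (a \<le> 1 \<longrightarrow>
           (\<forall>g. geodesic k a x y g \<longrightarrow> (\<forall>t\<in>{0..1}. g t = (1 - t) *\<^sub>R x + t *\<^sub>R y))) \<and>
        (1 < a \<longrightarrow>
           (\<forall>\<alpha>. 0 < \<alpha> \<and> \<alpha> < pi / 2 \<and> (sin \<alpha>)\<^sup>2 = 1 / a \<longrightarrow>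
              ((x, y) \<notin> frakC k a \<longrightarrow>
                 z_in k \<alpha> x y \<in> bdry k \<and> z_out k \<alpha> x y \<in> bdry k \<and>
                 (0 < x $ k \<longrightarrow> angle (x - z_in k \<alpha> x y) (axis k 1) = \<alpha>) \<and>
                 (0 < y $ k \<longrightarrow> angle (y - z_out k \<alpha> x y) (axis k 1) = \<alpha>) \<and>
                 (x $ k = 0 \<longrightarrow> z_in k \<alpha> x y = x) \<and>
                 (y $ k = 0 \<longrightarrow> z_out k \<alpha> x y = y) \<and>
                 closed_segment (z_in k \<alpha> x y) (z_out k \<alpha> x y) \<subseteq> bdry k \<and>
                 (\<forall>g. geodesic k a x y g \<longrightarrow> three_segments k \<alpha> x y g)) \<and>
              ((x, y) \<in> frakC k a \<longrightarrow>
                 geodesic k a x y (\<lambda>t. (1 - t) *\<^sub>R x + t *\<^sub>R y) \<and>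
                 (\<forall>g. geodesic k a x y g \<longrightarrow>
                    (\<forall>t\<in>{0..1}. g t = (1 - t) *\<^sub>R x + t *\<^sub>R y) \<or>
                    (x, y) \<in> cut_pairs k a \<and> three_segments k \<alpha> x y g)) \<and>
              ((x, y) \<in> cut_pairs k a \<longrightarrow>
                 (\<exists>g. geodesic k a x y g \<and> three_segments k \<alpha> x y g)))))"
proof (intro conjI ballI)
  show "lower_semicontinuous_map (subtopology weak_H1 (H1_halfspace k)) (dyn_cost k a)"
    by (rule dyn_cost_lower_semicontinuous)
  show "\<exists>\<kappa>>0. \<forall>w\<in>H1_halfspace k. ennreal (\<kappa> * energy w) \<le> dyn_cost k a w"
    using energy_le_action[of _ a k]
    by (intro exI[of _ "1 / (2 * max 1 a)"]) (auto simp: H1_halfspace_def dyn_cost_def)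
next
  fix x y :: "real ^ 'n" assume xy: "x \<in> halfspace k" "y \<in> halfspace k"
  show "ennreal (static_cost k a x y) \<in> action k a ` conn k x y"
    using minimizers_no_boundary_gain(2)[OF _ xy, of a] static_cost_attained(1)[OF _ xy, of a] by force
  show "ennreal (static_cost k a x y) \<le> action k a w" if "w \<in> conn k x y" for w
    using minimizers_no_boundary_gain(1)[OF _ xy that, of a] static_cost_attained(2)[OF _ xy that, of a] by force
  show "\<exists>g. geodesic k a x y g \<and>
      ((x, y) \<notin> cut_pairs k a \<longrightarrow> (\<forall>h. geodesic k a x y h \<longrightarrow> (\<forall>t\<in>{0..1}. h t = g t)))"
  proof (cases "a \<le> 1")
    case True
    then show ?thesis using minimizers_no_boundary_gain(3,4)[OF True xy] by blast
  next
    case False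
    then show ?thesis by (intro geodesic_essentially_unique xy) simp
  qed
  show "a \<le> 1 \<longrightarrow> (\<forall>g. geodesic k a x y g \<longrightarrow> (\<forall>t\<in>{0..1}. g t = (1 - t) *\<^sub>R x + t *\<^sub>R y))"
    using minimizers_no_boundary_gain(4)[OF _ xy] by blast
  show "1 < a \<longrightarrow>
     (\<forall>\<alpha>. 0 < \<alpha> \<and> \<alpha> < pi / 2 \<and> (sin \<alpha>)\<^sup>2 = 1 / a \<longrightarrow>
        ((x, y) \<notin> frakC k a \<longrightarrow>
           z_in k \<alpha> x y \<in> bdry k \<and> z_out k \<alpha> x y \<in> bdry k \<and>
           (0 < x $ k \<longrightarrow> angle (x - z_in k \<alpha> x y) (axis k 1) = \<alpha>) \<and>
           (0 < y $ k \<longrightarrow> angle (y - z_out k \<alpha> x y) (axis k 1) = \<alpha>) \<and>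
           (x $ k = 0 \<longrightarrow> z_in k \<alpha> x y = x) \<and>
           (y $ k = 0 \<longrightarrow> z_out k \<alpha> x y = y) \<and>
           closed_segment (z_in k \<alpha> x y) (z_out k \<alpha> x y) \<subseteq> bdry k \<and>
           (\<forall>g. geodesic k a x y g \<longrightarrow> three_segments k \<alpha> x y g)) \<and>
        ((x, y) \<in> frakC k a \<longrightarrow>
           geodesic k a x y (\<lambda>t. (1 - t) *\<^sub>R x + t *\<^sub>R y) \<and>
           (\<forall>g. geodesic k a x y g \<longrightarrow>
              (\<forall>t\<in>{0..1}. g t = (1 - t) *\<^sub>R x + t *\<^sub>R y) \<or>
              (x, y) \<in> cut_pairs k a \<and> three_segments k \<alpha> x y g)) \<and>
        ((x, y) \<in> cut_pairs k a \<longrightarrow>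
           (\<exists>g. geodesic k a x y g \<and> three_segments k \<alpha> x y g)))"
    (is "_ \<longrightarrow> (\<forall>\<alpha>. _ \<longrightarrow> ?P \<alpha>)")
  proof (intro impI allI)
    fix \<alpha> assume a: "1 < a" and "0 < \<alpha> \<and> \<alpha> < pi / 2 \<and> (sin \<alpha>)\<^sup>2 = 1 / a"
    then have \<alpha>: "0 < \<alpha>" "\<alpha> < pi / 2" "(sin \<alpha>)\<^sup>2 = 1 / a" by blast+
    note corners = geodesics_not_in_frakC[OF a xy \<alpha>]
    note lines = geodesics_in_frakC[OF a xy \<alpha>]
    note cut = cut_pairs_three_segments[OF a xy \<alpha>]
    show "?P \<alpha>"
      by (intro conjI impI allI corners lines cut)
  qed
qed

end
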